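(* Let $L\subset L_m$ be a partial staircase and let $c$ be a compatibility condition on $2^{\mathbf m}$. If the compatibility complex $\mathbf m^{(c)}_L$ triangulates the cone $GT_L$, then the $\mathbf m^{(c)}_L$-monomials $x_T=\prod_{I\in T}x_I$, where $T$ ranges over the $\mathbf m^{(c)}_L$-tableaux, form a $\mathbb C$-linear basis of the corresponding subalgebra of the Plücker algebra, i.e. of the subalgebra of $\mathbb C[x_{ij}: 1\le i,j\le m]$ generated by the minors $x_I$ with $I\in 2^{\mathbf m}_L$.
   Context: Subsets and shapes. Let $m\ge1$, $[m]=\{1,\dots,m\}$, and let $2^{\mathbf m}$ be the set of subsets of $[m]$. The source is $(0,0)$; the sinks of the staircase $L_m$ are the points $(m-k,k)$, $0\le k\le m$. A partial staircase $L\subset L_m$ is given by a nonempty set of selected sinks (the sinks of $L$): its nodes are the $(x,y)\in\mathbb Z_{\ge0}^2$ with $x\le a$, $y\le b$ for some selected sink $(a,b)$, and its edges are the unit horizontal and vertical segments joining two nodes of $L$. For $I\subseteq[m]$, $p(I)$ is the lattice path from $(0,0)$ of length $m$ whose $t$-th step is north $(0,1)$ if $t\in I$ and east $(1,0)$ otherwise. $2^{\mathbf m}_L$ is the set of $I$ such that $p(I)$ is contained in $L$ (equivalently, $(m-|I|,|I|)$ is a sink of $L$). Compatibility complexes. A compatibility condition $c$ is a choice of a collection of unordered pairs of subsets of $[m]$, called compatible pairs. $\mathbf m^{(c)}_L$ is the simplicial complex with vertex set $2^{\mathbf m}_L$ whose faces are the sets of pairwise compatible elements of $2^{\mathbf m}_L$.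 Gelfand-Tsetlin patterns. Cells are unit squares of the grid $\mathbb Z^2$. A cell is a cell of $L$ if its northwest or its southeast corner is a node of $L$; it is internal if all four corners are nodes of $L$, and external otherwise. Two external cells are connected if they are horizontally or vertically adjacent and the edge separating them is not an edge of $L$. A real-valued Gelfand-Tsetlin pattern of shape $L$ is a filling of the cells of $L$ with nonnegative reals, weakly increasing from west to east along rows and from north to south along columns, such that connected external cells have equal entries and the external cells to the west of $L$ (those in the column $-1\le x\le 0$) contain $0$. $GT_L$ is the cone of these patterns. For a path $p$ in $L$ from the source to a sink of $L$ with north and east steps, $T_p\in GT_L$ has entry $1$ in the cells to the southeast of $p$ and $0$ in the cells to the northwest of $p$. Triangulates. $\mathbf m^{(c)}_L$ triangulates $GT_L$ if every element of $GT_L$ can be uniquely decomposed into a positive linear combination of patterns $T_{p(I)}$ where the participating $I$ form a face of $\mathbf m^{(c)}_L$. Tableaux and minors. An $\mathbf m^{(c)}_L$-tableau supported on a face $F$ of $\mathbf m^{(c)}_L$ is a finite collection (multiset) of vertices belonging to $F$ in which each element of $F$ occurs at least once; an $\mathbf m^{(c)}_L$-tableau is one supported on some face. $X=(x_{ij})$ is an $m\times m$ matrix of indeterminates (rows numbered from the bottom), and $x_I$ is the minor of $X$ with column set $I$ and row set $\{1,\dots,|I|\}$. The Plücker algebra is the algebra generated by all $x_I$, $I\subseteq[m]$.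
   Formalization: Added assumption: every integer-valued pattern in GT_L decomposes with integer coefficients (unimodularity); without it the claim fails, e.g. for m=5 with sinks (3,2),(2,3). As x_∅=1, distinctness of the x_T is claimed only for tableaux not containing ∅. *)

theory Defs
  imports
    Complex_Main
    "HOL-Library.Poly_Mapping"
    "HOL-Library.Multiset"
    "Jordan_Normal_Form.Determinant"
    "Jordan_Normal_Form.DL_Submatrix"
begin

section \<open>Partial staircases and lattice paths\<close>

text \<open>Points of the grid are pairs (x, y) of integers. A partial staircase is represented by
  its set A of selected sinks.\<close>

definition sinks :: "nat \<Rightarrow> (int \<times> int) set" where
  "sinks m = {(int (m - k), int k) | k. k \<le> m}"

definition partial_staircase :: "nat \<Rightarrow> (int \<times> int) set \<Rightarrow> bool" where
  "partial_staircase m A \<longleftrightarrow> A \<noteq> {} \<and> A \<subseteq> sinks m"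

definition nodes :: "(int \<times> int) set \<Rightarrow> (int \<times> int) set" where
  "nodes A = {(x, y). 0 \<le> x \<and> 0 \<le> y \<and> (\<exists>(a, b) \<in> A. x \<le> a \<and> y \<le> b)}"

definition edges :: "(int \<times> int) set \<Rightarrow> (int \<times> int) set set" where
  "edges A = {{(x, y), (x + 1, y)} | x y. (x, y) \<in> nodes A \<and> (x + 1, y) \<in> nodes A}
           \<union> {{(x, y), (x, y + 1)} | x y. (x, y) \<in> nodes A \<and> (x, y + 1) \<in> nodes A}"

text \<open>The point reached by the path p(I) after t steps.\<close>

fun path_point :: "nat set \<Rightarrow> nat \<Rightarrow> int \<times> int" where
  "path_point I 0 = (0, 0)"
| "path_point I (Suc t) =
     (let (x, y) = path_point I t in if Suc t \<in> I then (x, y + 1) else (x + 1, y))"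

definition path_points :: "nat \<Rightarrow> nat set \<Rightarrow> (int \<times> int) set" where
  "path_points m I = path_point I ` {0..m}"

text \<open>An edge of the grid belongs to L as soon as its end points do, so that p(I) is contained
  in L iff its points are nodes of L.\<close>

definition subsets_in :: "nat \<Rightarrow> (int \<times> int) set \<Rightarrow> nat set set" where
  "subsets_in m A = {I. I \<subseteq> {1..m} \<and> path_points m I \<subseteq> nodes A}"


section \<open>Compatibility complexes\<close>

definition compatibility_condition :: "nat \<Rightarrow> nat set set set \<Rightarrow> bool" where
  "compatibility_condition m c \<longleftrightarrow> c \<subseteq> {{I, J} | I J. I \<subseteq> {1..m} \<and> J \<subseteq> {1..m}}"

definition faces :: "nat \<Rightarrow> (int \<times> int) set \<Rightarrow> nat set set set \<Rightarrow> nat set set set" where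
  "faces m A c = {F. F \<subseteq> subsets_in m A \<and> (\<forall>I \<in> F. \<forall>J \<in> F. I \<noteq> J \<longrightarrow> {I, J} \<in> c)}"


section \<open>Gelfand-Tsetlin patterns\<close>

text \<open>The pair (x, y) also denotes the cell whose southwest corner is the point (x, y).\<close>

definition cells :: "(int \<times> int) set \<Rightarrow> (int \<times> int) set" where
  "cells A = {(x, y). (x, y + 1) \<in> nodes A \<or> (x + 1, y) \<in> nodes A}"

definition internal_cells :: "(int \<times> int) set \<Rightarrow> (int \<times> int) set" where
  "internal_cells A = {(x, y). {(x, y), (x + 1, y), (x, y + 1), (x + 1, y + 1)} \<subseteq> nodes A}"

definition external_cells :: "(int \<times> int) set \<Rightarrow> (int \<times> int) set" where
  "external_cells A = cells A - internal_cells A"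

text \<open>It suffices to relate a cell to its east and to its north neighbour, because the relation
  is only used to force equality of entries.\<close>

definition connected_cells :: "(int \<times> int) set \<Rightarrow> int \<times> int \<Rightarrow> int \<times> int \<Rightarrow> bool" where
  "connected_cells A C D \<longleftrightarrow> C \<in> external_cells A \<and> D \<in> external_cells A \<and>
     (case C of (x, y) \<Rightarrow>
        (D = (x + 1, y) \<and> {(x + 1, y), (x + 1, y + 1)} \<notin> edges A) \<or>
        (D = (x, y + 1) \<and> {(x, y + 1), (x + 1, y + 1)} \<notin> edges A))"

text \<open>A filling of the cells of L is extended by 0 to all other cells of the grid.\<close>

definition GT :: "(int \<times> int) set \<Rightarrow> (int \<times> int \<Rightarrow> real) set" where
  "GT A = {T.
     (\<forall>C. C \<notin> cells A \<longrightarrow> T C = 0) \<and>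
     (\<forall>C \<in> cells A. 0 \<le> T C) \<and>
     (\<forall>x x' y. (x, y) \<in> cells A \<and> (x', y) \<in> cells A \<and> x \<le> x' \<longrightarrow> T (x, y) \<le> T (x', y)) \<and>
     (\<forall>x y y'. (x, y) \<in> cells A \<and> (x, y') \<in> cells A \<and> y' \<le> y \<longrightarrow> T (x, y) \<le> T (x, y')) \<and>
     (\<forall>C D. connected_cells A C D \<longrightarrow> T C = T D) \<and>
     (\<forall>y. (-1, y) \<in> external_cells A \<longrightarrow> T (-1, y) = 0)}"

text \<open>A cell is southeast of a path iff some point of the path lies weakly to the northwest of
  the northwest corner (x, y + 1) of the cell. For a cell of L and p(I) in L, the path meets the
  antidiagonal through the northwest and southeast corners of the cell, hence the cell is
  northwest of the path otherwise.\<close>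

definition path_pattern :: "nat \<Rightarrow> (int \<times> int) set \<Rightarrow> nat set \<Rightarrow> int \<times> int \<Rightarrow> real" where
  "path_pattern m A I = (\<lambda>(x, y).
     if (x, y) \<in> cells A \<and> (\<exists>(u, v) \<in> path_points m I. u \<le> x \<and> y + 1 \<le> v) then 1 else 0)"

text \<open>A positive linear combination whose participating sets form a face is encoded by its
  coefficient function, which vanishes precisely at the sets that do not participate.\<close>

definition decomposition ::
  "nat \<Rightarrow> (int \<times> int) set \<Rightarrow> nat set set set \<Rightarrow> (int \<times> int \<Rightarrow> real) \<Rightarrow> (nat set \<Rightarrow> real) \<Rightarrow> bool"
where
  "decomposition m A c T a \<longleftrightarrow>
     {I. a I \<noteq> 0} \<in> faces m A c \<and> (\<forall>I. 0 \<le> a I) \<and>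
     T = (\<lambda>C. \<Sum>I | a I \<noteq> 0. a I * path_pattern m A I C)"

definition triangulates :: "nat \<Rightarrow> (int \<times> int) set \<Rightarrow> nat set set set \<Rightarrow> bool" where
  "triangulates m A c \<longleftrightarrow> (\<forall>T \<in> GT A. \<exists>!a. decomposition m A c T a)"

text \<open>The condition that the decompositions respect the lattice of integer-valued patterns (the
  triangulation is unimodular). It does not follow from the previous one: for m = 5
  and the sinks (3,2), (2,3), declare all pairs compatible except the 36 pairs
  12|145, 12|234, 12|345, 124|13, 125|13, 125|134, 125|23, 125|234, 125|24, 13|145, 13|234,
  13|235, 13|24, 13|245, 13|25, 13|345, 134|235, 134|24, 134|245, 134|25, 135|24, 14|235, 14|345,
  145|23, 145|235, 145|24, 15|235, 15|24, 15|245, 15|34, 15|345, 23|345, 235|24, 24|345, 24|35,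
  245|35. The resulting complex triangulates the cone, but 14, 23, 135, 245 form a face for which
  half the sum of the four path patterns is integer-valued. The conclusion fails as well: 74
  pairs of a 2-set and a 3-set are compatible, while the span of the products of a 2-minor and a
  3-minor has dimension 75.\<close>

definition integral_decompositions ::
  "nat \<Rightarrow> (int \<times> int) set \<Rightarrow> nat set set set \<Rightarrow> bool" where
  "integral_decompositions m A c \<longleftrightarrow>
     (\<forall>T \<in> GT A. range T \<subseteq> \<int> \<longrightarrow> (\<exists>a. decomposition m A c T a \<and> range a \<subseteq> \<int>))"


section \<open>Minors and tableaux\<close>

text \<open>Polynomials with complex coefficients in the indeterminates x(i,j), where i and j range over
  all natural numbers; only those with i and j in {1..m} occur in the minors below. A polynomial
  maps exponent vectors to coefficients.\<close>

type_synonym cpoly = "((nat \<times> nat) \<Rightarrow>\<^sub>0 nat) \<Rightarrow>\<^sub>0 complex"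

definition const :: "complex \<Rightarrow> cpoly" where
  "const z = Poly_Mapping.single 0 z"

definition indet :: "nat \<Rightarrow> nat \<Rightarrow> cpoly" where
  "indet i j = Poly_Mapping.single (Poly_Mapping.single (i, j) 1) 1"

definition cscale :: "complex \<Rightarrow> cpoly \<Rightarrow> cpoly" where
  "cscale z p = const z * p"

interpretation cpoly: vector_space cscale
  by unfold_locales
    (simp_all add: cscale_def const_def distrib_left distrib_right single_add mult_single
      flip: mult.assoc)

text \<open>Matrix positions count from 0 and from the top, the indeterminates are numbered from 1 and
  their rows from the bottom.\<close>

definition generic_matrix :: "nat \<Rightarrow> cpoly mat" where
  "generic_matrix m = mat m m (\<lambda>(r, s). indet (m - r) (s + 1))"

text \<open>For empty I this is the determinant of the 0 by 0 matrix, that is 1. Inserting copies of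
  the empty set into a tableau therefore does not change its monomial, and the tableau monomials
  can only be pairwise distinct for the tableaux without the empty set (these are all tableaux if
  the sink (m, 0) is not selected).\<close>

definition minor :: "nat \<Rightarrow> nat set \<Rightarrow> cpoly" where
  "minor m I =
     det (submatrix (generic_matrix m) {r. r < m \<and> m - r \<in> {1..card I}} {s. s + 1 \<in> I})"

definition tableaux_on ::
  "nat \<Rightarrow> (int \<times> int) set \<Rightarrow> nat set set set \<Rightarrow> nat set set \<Rightarrow> nat set multiset set" where
  "tableaux_on m A c F = {T. F \<in> faces m A c \<and> set_mset T = F}"

definition tableaux :: "nat \<Rightarrow> (int \<times> int) set \<Rightarrow> nat set set set \<Rightarrow> nat set multiset set" where
  "tableaux m A c = (\<Union>F. tableaux_on m A c F)"

definition tableau_monomial :: "nat \<Rightarrow> nat set multiset \<Rightarrow> cpoly" where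
  "tableau_monomial m T = (\<Prod>I \<in># T. minor m I)"

inductive_set generated_subalgebra :: "cpoly set \<Rightarrow> cpoly set" for G :: "cpoly set" where
  const: "const z \<in> generated_subalgebra G"
| gen: "p \<in> G \<Longrightarrow> p \<in> generated_subalgebra G"
| add: "p \<in> generated_subalgebra G \<Longrightarrow> q \<in> generated_subalgebra G \<Longrightarrow> p + q \<in> generated_subalgebra G"
| mult: "p \<in> generated_subalgebra G \<Longrightarrow> q \<in> generated_subalgebra G \<Longrightarrow> p * q \<in> generated_subalgebra G"

end

theory Submission
  imports Defs
begin

text \<open>Give the indeterminate x(i,j) the weight i j. By the rearrangement inequality, a minor has a
  unique monomial of maximal weight, its diagonal term, and the exponents of this term mark the north
  steps of the lattice path. Hence adding up the patterns of the paths in a tableau amounts to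
  multiplying the initial monomials of its minors, and the uniqueness of decompositions says that
  different tableaux without the empty set have different initial monomials. This gives linear
  independence.

  For spanning, the minors are invariant under adding a lower row to the next one. A polynomial
  with this property that is homogeneous in each row can only have exponents of semistandard
  tableaux as exponents of maximal weight. These define integral Gelfand-Tsetlin patterns, so the
  decomposition of the pattern yields a tableau with the same initial monomial. Subtracting multiples
  of the tableau monomials lowers the maximal weight, and the process stops at 0.\<close>

text \<open>The weight does not order all exponents, so a polynomial may have several exponents of
  maximal weight. Hence \<open>lead\<close> asks for a strict maximum, which minors and their
  products have, while the reduction of a general polynomial also counts its exponents of top
  weight.

  Only row invariance and a fixed degree in each row are kept of a polynomial during the reduction,
  as both pass to differences. The row degrees record the shape: they change only at heights of
  selected sinks, and they force the tableau found for a top exponent to have the shape of the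
  polynomial being reduced. Integrality enters there, because the coefficients of a decomposition
  become multiplicities.

  The empty set is the one vertex that exponents cannot see, its minor being 1, whereas its pattern
  is visible in the cells below the staircase.\<close>

abbreviation "lookup \<equiv> Poly_Mapping.lookup"
abbreviation "keys \<equiv> Poly_Mapping.keys"

type_synonym expo = "(nat \<times> nat) \<Rightarrow>\<^sub>0 nat"

section \<open>Weights and leading exponents\<close>

text \<open>Integers are used because, besides \<open>prodwt\<close>, indicator functions and their
  negatives serve as weights, to bound exponents from above and from below.\<close>

definition wt :: "('a \<Rightarrow> int) \<Rightarrow> ('a \<Rightarrow>\<^sub>0 nat) \<Rightarrow> int" where
  "wt u e = (\<Sum>x\<in>keys e. u x * int (lookup e x))"

lemma wt_superset:
  assumes "finite S" "keys e \<subseteq> S"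
  shows "wt u e = (\<Sum>x\<in>S. u x * int (lookup e x))"
  unfolding wt_def using assms by (intro sum.mono_neutral_left) (auto simp: in_keys_iff)

lemma wt_zero [simp]: "wt u 0 = 0"
  by (simp add: wt_def)

lemma wt_add: "wt u (e + e') = wt u e + wt u e'"
proof -
  have "wt u (e + e') = (\<Sum>x\<in>keys e \<union> keys e'. u x * int (lookup (e + e') x))"
    by (rule wt_superset) (use keys_add[of e e'] in auto)
  also have "\<dots> = wt u e + wt u e'"
    unfolding wt_superset[of "keys e \<union> keys e'" e, simplified] wt_superset[of "keys e \<union> keys e'" e', simplified]
    by (simp add: lookup_add algebra_simps sum.distrib)
  finally show ?thesis .
qed

lemma wt_single [simp]: "wt u (Poly_Mapping.single x n) = u x * int n"
  by (cases "n = 0") (simp_all add: wt_def)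

lemma wt_sum: "wt u (sum f S) = (\<Sum>i\<in>S. wt u (f i))"
  by (induction S rule: infinite_finite_induct) (simp_all add: wt_add)

lemma wt_indicator:
  assumes "finite S"
  shows "wt (\<lambda>x. of_bool (x \<in> S)) e = (\<Sum>x\<in>S. int (lookup e x))"
proof -
  have "wt (\<lambda>x. of_bool (x \<in> S)) e = (\<Sum>x\<in>keys e \<union> S. of_bool (x \<in> S) * int (lookup e x))"
    using assms by (intro wt_superset) auto
  also have "\<dots> = (\<Sum>x\<in>S. int (lookup e x))"
    using assms by (intro sum.mono_neutral_cong_right) auto
  finally show ?thesis .
qed

lemma keys_mult_wt_le:
  fixes p q :: cpoly
  assumes "\<And>k. k \<in> keys p \<Longrightarrow> wt u k \<le> a" "\<And>k. k \<in> keys q \<Longrightarrow> wt u k \<le> b"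
    and "k \<in> keys (p * q)"
  shows "wt u k \<le> a + b"
proof -
  obtain x y where "k = x + y" "x \<in> keys p" "y \<in> keys q"
    using assms(3) keys_mult[of p q] by blast
  then show ?thesis
    using assms(1)[of x] assms(2)[of y] by (simp add: wt_add)
qed

definition lead :: "(nat \<times> nat \<Rightarrow> int) \<Rightarrow> cpoly \<Rightarrow> expo \<Rightarrow> bool" where
  "lead u p e \<longleftrightarrow> lookup p e \<noteq> 0 \<and> (\<forall>k\<in>keys p. k \<noteq> e \<longrightarrow> wt u k < wt u e)"

lemma lead_unique: "lead u p e \<Longrightarrow> lead u p e' \<Longrightarrow> e = e'"
  unfolding lead_def by (metis in_keys_iff less_asym)

lemma lead_wt_le: "lead u p e \<Longrightarrow> k \<in> keys p \<Longrightarrow> wt u k \<le> wt u e"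
  unfolding lead_def by (cases "k = e") auto

lemma lead_one: "lead u 1 0"
  by (simp add: lead_def)

text \<open>Split each factor into its leading term and terms of strictly smaller weight. As weights
  add, all other products fall strictly below \<open>a + b\<close> and cannot cancel the product of
  the leading coefficients.\<close>

lemma lead_mult:
  assumes p: "lead u p a" and q: "lead u q b"
  shows "lead u (p * q) (a + b)"
proof -
  define c d where "c = lookup p a" and "d = lookup q b"
  define p' q' where "p' = p - Poly_Mapping.single a c" and "q' = q - Poly_Mapping.single b d"
  have p': "wt u k < wt u a" if "k \<in> keys p'" for k
    using that p unfolding p'_def c_def lead_def
    by (cases "k = a") (auto simp: in_keys_iff lookup_minus lookup_single)
  have q': "wt u k < wt u b" if "k \<in> keys q'" for k
    using that q unfolding q'_def d_def lead_def
    by (cases "k = b") (auto simp: in_keys_iff lookup_minus lookup_single)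
  define r where "r = Poly_Mapping.single a c * q' + p' * q"
  have eq: "p * q = Poly_Mapping.single (a + b) (c * d) + r"
  proof -
    have "p * q = P * Q + (P * (q - Q) + (p - P) * q)" for P Q :: cpoly
      by (simp add: right_diff_distrib left_diff_distrib)
    then show ?thesis
      unfolding r_def p'_def q'_def mult_single[symmetric] .
  qed
  have r: "wt u k < wt u (a + b)" if "k \<in> keys r" for k
  proof -
    have "k \<in> keys (Poly_Mapping.single a c * q') \<or> k \<in> keys (p' * q)"
      using that keys_add[of "Poly_Mapping.single a c * q'" "p' * q"] unfolding r_def by auto
    then show ?thesis
    proof
      assume "k \<in> keys (Poly_Mapping.single a c * q')"
      then obtain x where "x \<in> keys q'" "k = a + x"
        using keys_mult[of "Poly_Mapping.single a c" q'] by (auto split: if_splits)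
      then show ?thesis using q' by (simp add: wt_add)
    next
      assume "k \<in> keys (p' * q)"
      then obtain x y where "x \<in> keys p'" "y \<in> keys q" "k = x + y"
        using keys_mult[of p' q] by blast
      then show ?thesis using p'[of x] lead_wt_le[OF q, of y] by (simp add: wt_add)
    qed
  qed
  have "lookup r (a + b) = 0"
    using r by (metis in_keys_iff less_irrefl)
  moreover have "c * d \<noteq> 0"
    using p q by (simp add: c_def d_def lead_def)
  moreover have "wt u k < wt u (a + b)" if "k \<in> keys (p * q)" "k \<noteq> a + b" for k
    using that r keys_add[of "Poly_Mapping.single (a + b) (c * d)" r] unfolding eq
    by (auto split: if_splits)
  ultimately show ?thesis
    unfolding lead_def by (simp add: eq lookup_add)
qed

lemma lead_prod_mset:
  assumes "\<And>x. x \<in># M \<Longrightarrow> lead u (p x) (e x)"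
  shows "lead u (\<Prod>x\<in>#M. p x) (\<Sum>x\<in>#M. e x)"
  using assms by (induction M) (simp_all add: lead_one lead_mult)

lemma lead_power: "lead u p e \<Longrightarrow> lead u (p ^ n) (\<Sum>i<n. e)"
  by (induction n) (simp_all add: lead_one lead_mult add.commute[of _ e])

lemma lead_prod:
  assumes "\<And>x. x \<in> S \<Longrightarrow> lead u (p x) (e x)"
  shows "lead u (\<Prod>x\<in>S. p x) (\<Sum>x\<in>S. e x)"
  using assms by (induction S rule: infinite_finite_induct) (simp_all add: lead_one lead_mult)

section \<open>Substitution\<close>

definition subst_mon :: "(nat \<times> nat \<Rightarrow> cpoly) \<Rightarrow> expo \<Rightarrow> cpoly" where
  "subst_mon v e = (\<Prod>x\<in>keys e. v x ^ lookup e x)"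

definition subst :: "(nat \<times> nat \<Rightarrow> cpoly) \<Rightarrow> cpoly \<Rightarrow> cpoly" where
  "subst v p = (\<Sum>e\<in>keys p. const (lookup p e) * subst_mon v e)"

lemma subst_mon_superset:
  assumes "finite S" "keys e \<subseteq> S"
  shows "subst_mon v e = (\<Prod>x\<in>S. v x ^ lookup e x)"
  unfolding subst_mon_def using assms by (intro prod.mono_neutral_left) (auto simp: in_keys_iff)

lemma subst_mon_add: "subst_mon v (e + e') = subst_mon v e * subst_mon v e'"
proof -
  have "subst_mon v (e + e') = (\<Prod>x\<in>keys e \<union> keys e'. v x ^ lookup (e + e') x)"
    by (rule subst_mon_superset) (use keys_add[of e e'] in auto)
  also have "\<dots> = subst_mon v e * subst_mon v e'"
    unfolding subst_mon_superset[of "keys e \<union> keys e'" e, simplified]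
      subst_mon_superset[of "keys e \<union> keys e'" e', simplified]
    by (simp add: lookup_add power_add prod.distrib)
  finally show ?thesis .
qed

lemma const_add: "const (a + b) = const a + const b"
  by (simp add: const_def single_add)

lemma const_mult: "const (a * b) = const a * const b"
  by (simp add: const_def mult_single)

lemma const_0 [simp]: "const 0 = 0" and const_1 [simp]: "const 1 = 1"
  by (simp_all add: const_def)

lemma subst_superset:
  assumes "finite S" "keys p \<subseteq> S"
  shows "subst v p = (\<Sum>e\<in>S. const (lookup p e) * subst_mon v e)"
  unfolding subst_def using assms by (intro sum.mono_neutral_left) (auto simp: in_keys_iff)

lemma subst_add: "subst v (p + q) = subst v p + subst v q"
proof -
  have "subst v (p + q) = (\<Sum>e\<in>keys p \<union> keys q. const (lookup (p + q) e) * subst_mon v e)"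
    by (rule subst_superset) (use keys_add[of p q] in auto)
  also have "\<dots> = subst v p + subst v q"
    unfolding subst_superset[of "keys p \<union> keys q" p, simplified]
      subst_superset[of "keys p \<union> keys q" q, simplified]
    by (simp add: lookup_add const_add algebra_simps sum.distrib)
  finally show ?thesis .
qed

lemma subst_zero [simp]: "subst v 0 = 0"
  by (simp add: subst_def)

lemma subst_sum: "subst v (sum f S) = (\<Sum>i\<in>S. subst v (f i))"
  by (induction S rule: infinite_finite_induct) (simp_all add: subst_add)

lemma subst_single: "subst v (Poly_Mapping.single e c) = const c * subst_mon v e"
  by (cases "c = 0") (simp_all add: subst_def)

lemma cpoly_sum_monomials: "p = (\<Sum>e\<in>keys p. Poly_Mapping.single e (lookup p e))"
proof (rule poly_mapping_eqI)
  fix k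
  show "lookup p k = lookup (\<Sum>e\<in>keys p. Poly_Mapping.single e (lookup p e)) k"
    by (cases "k \<in> keys p")
      (auto simp: lookup_sum lookup_single when_def sum.delta in_keys_iff intro!: sum.neutral)
qed

lemma subst_mult: "subst v (p * q) = subst v p * subst v q"
proof -
  have "p * q = (\<Sum>e\<in>keys p. \<Sum>f\<in>keys q. Poly_Mapping.single (e + f) (lookup p e * lookup q f))"
    unfolding mult_single[symmetric] sum_product[symmetric] cpoly_sum_monomials[symmetric] ..
  then have "subst v (p * q) = (\<Sum>e\<in>keys p. \<Sum>f\<in>keys q.
      const (lookup p e * lookup q f) * subst_mon v (e + f))"
    by (simp add: subst_sum subst_single)
  also have "\<dots> = subst v p * subst v q"
    by (simp add: subst_def sum_product const_mult subst_mon_add algebra_simps)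
  finally show ?thesis .
qed

lemma subst_one [simp]: "subst v 1 = 1"
  using subst_single[of v 0 1] by (simp add: subst_mon_def)

lemma subst_indet [simp]: "subst v (indet i j) = v (i, j)"
  unfolding indet_def subst_single by (simp add: subst_mon_def)

lemma subst_const [simp]: "subst v (const c) = const c"
  unfolding const_def subst_single by (simp add: subst_mon_def const_def)

text \<open>A ring homomorphism commutes with determinants; this is how row operations on
  substituted values reach the minors.\<close>

interpretation subst: comm_ring_hom "subst v" for v
  by unfold_locales (simp_all add: subst_add subst_mult)

lemma subst_prod_mset: "subst v (\<Prod>x\<in>#M. p x) = (\<Prod>x\<in>#M. subst v (p x))"
  by (induction M) (simp_all add: subst_mult)

lemma keys_power_wt_le:
  fixes p :: cpoly
  assumes "\<And>k. k \<in> keys p \<Longrightarrow> wt u k \<le> a" and "k \<in> keys (p ^ n)"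
  shows "wt u k \<le> a * int n"
  using assms(2)
proof (induction n arbitrary: k)
  case (Suc n)
  have "wt u k \<le> a + a * int n"
    by (rule keys_mult_wt_le[of p _ _ "p ^ n"]) (use assms(1) Suc in auto)
  then show ?case by (simp add: algebra_simps)
qed simp

lemma keys_subst_mon_wt_le:
  assumes v: "\<And>x k. lookup e x \<noteq> 0 \<Longrightarrow> k \<in> keys (v x) \<Longrightarrow> wt u k \<le> t x"
    and k: "k \<in> keys (subst_mon v e)"
  shows "wt u k \<le> wt t e"
proof -
  have "wt u k \<le> (\<Sum>x\<in>S. t x * int (lookup e x))"
    if "finite S" "S \<subseteq> keys e" "k \<in> keys (\<Prod>x\<in>S. v x ^ lookup e x)" for S k
    using that
  proof (induction S arbitrary: k rule: finite_induct)
    case (insert y S)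
    have "wt u k \<le> t y * int (lookup e y) + (\<Sum>x\<in>S. t x * int (lookup e x))"
    proof (rule keys_mult_wt_le)
      show "wt u k \<le> t y * int (lookup e y)" if "k \<in> keys (v y ^ lookup e y)" for k
        using that insert.prems(1) by (intro keys_power_wt_le[of "v y"]) (auto intro: v simp: in_keys_iff)
    qed (use insert in auto)
    then show ?case using insert by simp
  qed simp
  from this[of "keys e" k] show ?thesis
    using k unfolding subst_mon_def wt_def by simp
qed

lemma lead_subst_mon:
  assumes "\<And>x. lookup e x \<noteq> 0 \<Longrightarrow> lead u (v x) (t x)"
  shows "lead u (subst_mon v e) (\<Sum>x\<in>keys e. \<Sum>i<lookup e x. t x)"
  unfolding subst_mon_def by (intro lead_prod lead_power assms) (simp add: in_keys_iff)

section \<open>Minors\<close>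

text \<open>The values below \<open>p a\<close> are exactly those taken at the positions after
  \<open>a\<close>, and there are \<open>k - Suc a\<close> of these.\<close>

lemma permutation_strict_antimono:
  assumes p: "p permutes {0..<k}" and anti: "\<And>a b. a < b \<Longrightarrow> b < k \<Longrightarrow> p b < p a"
    and a: "a < k"
  shows "p a = k - Suc a"
proof -
  have "{..<p a} = p ` {a<..<k}"
  proof (intro equalityI subsetI)
    fix x assume x: "x \<in> {..<p a}"
    moreover have "p a < k" using permutes_in_image[OF p, of a] a by simp
    ultimately have "x \<in> p ` {0..<k}" using permutes_image[OF p] by auto
    then obtain b where b: "b < k" "x = p b" by auto
    have "\<not> b < a" using anti[of b a] a x b by auto
    moreover have "b \<noteq> a" using x b by auto
    ultimately show "x \<in> p ` {a<..<k}" using b by auto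
  qed (use anti in auto)
  then have "p a = card (p ` {a<..<k})" by (metis card_lessThan)
  also have "\<dots> = card {a<..<k}"
    by (rule card_image) (use permutes_inj[OF p] in \<open>auto intro: inj_on_subset\<close>)
  finally show ?thesis by simp
qed

text \<open>Position \<open>a\<close> in a minor of size \<open>k\<close> carries the row number
  \<open>k - a\<close>, rows being numbered from the bottom. The diagonal term, in which row numbers
  and columns increase together, is therefore the antidiagonal of the matrix.\<close>

definition rev_perm :: "nat \<Rightarrow> nat \<Rightarrow> nat" where
  "rev_perm k a = (if a < k then k - Suc a else a)"

lemma rev_perm_permutes: "rev_perm k permutes {0..<k}"
proof (rule bij_imp_permutes)
  show "bij_betw (rev_perm k) {0..<k} {0..<k}"
    by (rule bij_betwI[where g = "rev_perm k"]) (auto simp: rev_perm_def)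
qed (simp add: rev_perm_def)

text \<open>A permutation of maximal weight has no ascent, as exchanging its two values would increase the
  weight.\<close>

lemma rearrangement_strict:
  fixes g :: "nat \<Rightarrow> int"
  assumes g: "\<And>a b. a < b \<Longrightarrow> b < k \<Longrightarrow> g a < g b"
    and p: "p permutes {0..<k}" and ne: "p \<noteq> rev_perm k"
  shows "(\<Sum>a<k. int (k - a) * g (p a)) < (\<Sum>a<k. int (k - a) * g (rev_perm k a))"
proof -
  define W where "W p = (\<Sum>a<k. int (k - a) * g (p a))" for p
  let ?P = "{p. p permutes {0..<k}}"
  have max_rev: "q = rev_perm k" if q: "q permutes {0..<k}" and qmax: "\<And>q'. q' permutes {0..<k} \<Longrightarrow> W q' \<le> W q" for q
  proof -
    have anti: "q b < q a" if ab: "a < b" "b < k" for a b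
    proof (rule ccontr)
      assume "\<not> q b < q a"
      moreover have "q a \<noteq> q b" using permutes_inj[OF q] ab by (auto dest: injD)
      ultimately have lt: "q a < q b" by simp
      have qb: "q b < k" using permutes_in_image[OF q, of b] ab by simp
      define q' where "q' = q \<circ> transpose a b"
      have q': "q' permutes {0..<k}"
        unfolding q'_def by (rule permutes_compose[OF permutes_swap_id q]) (use ab in auto)
      have split: "W f = int (k - a) * g (f a) + (int (k - b) * g (f b) + (\<Sum>x\<in>{..<k} - {a} - {b}. int (k - x) * g (f x)))" for f
        unfolding W_def using ab
        by (subst sum.remove[of _ a], simp_all, subst sum.remove[of _ b], simp_all)
      have "(\<Sum>x\<in>{..<k} - {a} - {b}. int (k - x) * g (q' x)) = (\<Sum>x\<in>{..<k} - {a} - {b}. int (k - x) * g (q x))"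
        by (rule sum.cong) (auto simp: q'_def transpose_def)
      then have "W q' - W q = (int (k - a) - int (k - b)) * (g (q b) - g (q a))"
        unfolding split by (simp add: q'_def algebra_simps)
      also have "\<dots> > 0"
        using g[OF lt qb] ab by (intro mult_pos_pos) auto
      finally show False using qmax[OF q'] by simp
    qed
    show ?thesis
    proof
      fix a show "q a = rev_perm k a"
        using permutation_strict_antimono[OF q anti, of a] permutes_not_in[OF q, of a]
        by (auto simp: rev_perm_def)
    qed
  qed
  \<comment> \<open>Finiteness supplies a maximiser, which has to be the reversal; a permutation of
    the same weight would be a maximiser as well.\<close>
  have fin: "finite (W ` ?P)" by (simp add: finite_permutations)
  have "Max (W ` ?P) \<in> W ` ?P" by (rule Max_in) (use fin p in auto)
  then obtain q where q: "q permutes {0..<k}" "W q = Max (W ` ?P)" by auto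
  have qmax: "W q' \<le> W q" if "q' permutes {0..<k}" for q'
    unfolding q(2) by (rule Max_ge) (use fin that in auto)
  have "q = rev_perm k" by (rule max_rev[OF q(1) qmax])
  moreover have "W p \<noteq> W q"
    using max_rev[OF p] qmax ne by auto
  ultimately have "W p < W (rev_perm k)" using qmax[OF p] by simp
  then show ?thesis by (simp add: W_def)
qed

text \<open>For \<open>b < card I\<close>, the element of \<open>I\<close> with \<open>b\<close>
  smaller ones. It is written through \<open>pick\<close> and a shift by one because
  \<open>submatrix\<close> selects columns in this way, counting from 0.\<close>

definition column :: "nat set \<Rightarrow> nat \<Rightarrow> nat" where
  "column I b = Suc (pick {s. Suc s \<in> I} b)"

lemma card_Suc_vimage:
  assumes "I \<subseteq> {1..m}"
  shows "card {s. Suc s \<in> I} = card I"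
proof -
  have "x \<in> Suc ` {s. Suc s \<in> I}" if "x \<in> I" for x
    using that assms by (cases x) auto
  then have "Suc ` {s. Suc s \<in> I} = I" by auto
  then show ?thesis by (metis card_image inj_Suc)
qed

context
  fixes m :: nat and I :: "nat set"
  assumes I: "I \<subseteq> {1..m}"
begin

lemma column_in: "b < card I \<Longrightarrow> column I b \<in> I"
  using pick_in_set[of b "{s. s + 1 \<in> I}"] by (simp add: column_def card_Suc_vimage[OF I])

lemma column_less: "a < b \<Longrightarrow> b < card I \<Longrightarrow> column I a < column I b"
  using pick_mono_le[of b "{s. s + 1 \<in> I}" a] by (simp add: column_def card_Suc_vimage[OF I])

lemma column_bij: "bij_betw (column I) {..<card I} I"
proof -
  have fin: "finite I" using I finite_subset by blast
  have inj: "inj_on (column I) {..<card I}"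
    by (rule linorder_inj_onI) (use column_less in fastforce)+
  have "column I ` {..<card I} \<subseteq> I" using column_in by auto
  then have "column I ` {..<card I} = I"
    using fin inj by (metis card_image card_lessThan card_subset_eq)
  with inj show ?thesis by (simp add: bij_betw_def)
qed

lemma card_upto_column:
  assumes b: "b < card I"
  shows "card (I \<inter> {1..column I b}) = Suc b"
proof -
  have "I \<inter> {1..column I b} = column I ` {..b}"
  proof (intro equalityI subsetI)
    fix x assume x: "x \<in> I \<inter> {1..column I b}"
    then obtain a where a: "a < card I" "x = column I a"
      using column_bij by (auto simp: bij_betw_def)
    with x have "\<not> b < a" using column_less[of b a] by auto
    then show "x \<in> column I ` {..b}" using a by auto
  next
    fix x assume "x \<in> column I ` {..b}"
    then obtain a where a: "a \<le> b" "x = column I a" by auto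
    have "x \<in> I" using a b column_in by auto
    moreover have "x \<le> column I b"
      using a b column_less[of a b] by (cases "a = b") auto
    ultimately show "x \<in> I \<inter> {1..column I b}" using I by auto
  qed
  moreover have "inj_on (column I) {..b}"
    using column_bij b by (auto simp: bij_betw_def intro: inj_on_subset)
  ultimately show ?thesis by (simp add: card_image)
qed

lemma card_le_m: "card I \<le> m"
  using card_mono[OF _ I] by simp

lemma minor_eq: "minor m I = det (mat (card I) (card I) (\<lambda>(a, b). indet (card I - a) (column I b)))"
proof -
  define k R C where "k = card I" and "R = {r. r < m \<and> m - r \<in> {1..k}}" and "C = {s. s + 1 \<in> I}"
  have km: "k \<le> m" using card_le_m by (simp add: k_def)
  have R: "R = {m - k..<m}" using km by (auto simp: R_def)
  have "{i. i < m \<and> i \<in> R} = {m - k..<m}" by (auto simp: R)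
  then have cR: "card {i. i < m \<and> i \<in> R} = k" using km by simp
  have "{i. i < m \<and> i \<in> C} = C" using I by (auto simp: C_def)
  then have cC: "card {i. i < m \<and> i \<in> C} = k" using card_Suc_vimage[OF I] by (simp add: C_def k_def)
  \<comment> \<open>The selected rows are the positions from \<open>m - k\<close> on, so position
    \<open>a\<close> of the submatrix has row number \<open>m - (m - k + a) = k - a\<close>.\<close>
  have pick_row: "pick R a = m - k + a" if "a < k" for a
  proof -
    have "{x \<in> R. x < m - k + a} = {m - k..<m - k + a}" using that km by (auto simp: R)
    then have "card {x \<in> R. x < m - k + a} = a" by simp
    moreover have "m - k + a \<in> R" using km that by (auto simp: R)
    ultimately show ?thesis using pick_card_in_set[of "m - k + a" R] by simp
  qed
  have pick_col: "pick C b < m \<and> Suc (pick C b) = column I b" if "b < k" for b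
    using column_in[of b] I that by (auto simp: column_def C_def k_def)
  have "submatrix (generic_matrix m) R C = mat k k (\<lambda>(a, b). indet (k - a) (column I b))"
  proof (rule eq_matI)
    fix a b
    assume "a < dim_row (mat k k (\<lambda>(a, b). indet (k - a) (column I b)))"
      and "b < dim_col (mat k k (\<lambda>(a, b). indet (k - a) (column I b)))"
    then have ab: "a < k" "b < k" by auto
    have "submatrix (generic_matrix m) R C $$ (a, b) = generic_matrix m $$ (pick R a, pick C b)"
      by (rule submatrix_index) (use ab in \<open>simp_all add: generic_matrix_def cR cC\<close>)
    then show "submatrix (generic_matrix m) R C $$ (a, b)
        = mat k k (\<lambda>(a, b). indet (k - a) (column I b)) $$ (a, b)"
      using ab km pick_col[OF ab(2)] by (simp add: pick_row[OF ab(1)] generic_matrix_def)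
  qed (simp_all add: dim_submatrix generic_matrix_def cR cC)
  then show ?thesis by (simp add: minor_def R_def C_def k_def)
qed

end

text \<open>Exponent of the diagonal term: the rank of \<open>j\<close> in \<open>I\<close> is both
  the row of the factor in column \<open>j\<close> and the height of p(I) after its north step
  \<open>j\<close>.\<close>

definition path_exp :: "nat set \<Rightarrow> expo" where
  "path_exp I = (\<Sum>j\<in>I. Poly_Mapping.single (card (I \<inter> {1..j}), j) 1)"

lemma lookup_path_exp:
  assumes "finite I"
  shows "lookup (path_exp I) (r, j) = of_bool (j \<in> I \<and> card (I \<inter> {1..j}) = r)"
proof -
  have "lookup (path_exp I) (r, j) = (\<Sum>i\<in>I. if i = j then of_bool (card (I \<inter> {1..j}) = r) else 0)"
    unfolding path_exp_def lookup_sum lookup_single when_def by (intro sum.cong) auto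
  also have "\<dots> = of_bool (j \<in> I \<and> card (I \<inter> {1..j}) = r)" using assms by simp
  finally show ?thesis .
qed

abbreviation prodwt :: "nat \<times> nat \<Rightarrow> int" where
  "prodwt \<equiv> \<lambda>(r, j). int r * int j"

definition term_exp :: "nat set \<Rightarrow> (nat \<Rightarrow> nat) \<Rightarrow> expo" where
  "term_exp I p = (\<Sum>a<card I. Poly_Mapping.single (card I - a, column I (p a)) 1)"

lemma prod_single: "(\<Prod>a\<in>S. Poly_Mapping.single (f a) (1::complex)) = Poly_Mapping.single (\<Sum>a\<in>S. f a) 1"
  by (induction S rule: infinite_finite_induct) (simp_all add: mult_single)

section \<open>Row degrees and invariance under row operations\<close>

definition rowdeg :: "nat \<Rightarrow> nat \<Rightarrow> expo \<Rightarrow> nat" where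
  "rowdeg m r e = (\<Sum>j=1..m. lookup e (r, j))"

lemma rowdeg_add: "rowdeg m r (e + e') = rowdeg m r e + rowdeg m r e'"
  by (simp add: rowdeg_def lookup_add sum.distrib)

lemma rowdeg_zero [simp]: "rowdeg m r 0 = 0"
  by (simp add: rowdeg_def)

lemma rowdeg_sum: "rowdeg m r (sum f S) = (\<Sum>i\<in>S. rowdeg m r (f i))"
  by (induction S rule: infinite_finite_induct) (simp_all add: rowdeg_add)

lemma rowdeg_single: "j \<in> {1..m} \<Longrightarrow> rowdeg m r (Poly_Mapping.single (i, j) 1) = of_bool (i = r)"
  by (auto simp: rowdeg_def lookup_single when_def)

definition row_homogeneous :: "nat \<Rightarrow> (nat \<Rightarrow> nat) \<Rightarrow> cpoly \<Rightarrow> bool" where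
  "row_homogeneous m d f \<longleftrightarrow>
     (\<forall>e\<in>keys f. keys e \<subseteq> {1..m} \<times> {1..m} \<and> (\<forall>r. rowdeg m r e = d r))"

definition row_op :: "nat \<Rightarrow> (nat \<times> nat \<Rightarrow> cpoly) \<Rightarrow> nat \<times> nat \<Rightarrow> cpoly" where
  "row_op r v = (\<lambda>(i, j). if i = Suc r then v (r, j) + v (i, j) else v (i, j))"

text \<open>Quantifying over all substitutions, not just the indeterminates, allows values such as 0
  or negated indeterminates to be plugged in, as the interlacing argument does.\<close>

definition row_invariant :: "cpoly \<Rightarrow> bool" where
  "row_invariant f \<longleftrightarrow> (\<forall>r v. 1 \<le> r \<longrightarrow> subst (row_op r v) f = subst v f)"

context
  fixes m :: nat and I :: "nat set"
  assumes I: "I \<subseteq> {1..m}"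
begin

lemma minor_leibniz:
  "minor m I = (\<Sum>p | p permutes {0..<card I}. Poly_Mapping.single (term_exp I p) (signof p))"
proof -
  have "minor m I = (\<Sum>p | p permutes {0..<card I}.
      signof p * (\<Prod>a = 0..<card I. mat (card I) (card I) (\<lambda>(a, b). indet (card I - a) (column I b)) $$ (a, p a)))"
    unfolding minor_eq[OF I] by (rule det_def') auto
  also have "\<dots> = (\<Sum>p | p permutes {0..<card I}. Poly_Mapping.single (term_exp I p) (signof p))"
  proof (rule sum.cong[OF refl])
    fix p assume "p \<in> {p. p permutes {0..<card I}}"
    then have p: "p a < card I" if "a < card I" for a
      using that permutes_in_image[of p "{0..<card I}" a] by simp
    have "(\<Prod>a = 0..<card I. mat (card I) (card I) (\<lambda>(a, b). indet (card I - a) (column I b)) $$ (a, p a))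
        = (\<Prod>a<card I. Poly_Mapping.single (Poly_Mapping.single (card I - a, column I (p a)) 1) 1)"
      by (rule prod.cong) (auto simp: p indet_def)
    also have "\<dots> = Poly_Mapping.single (term_exp I p) 1"
      by (simp add: prod_single term_exp_def)
    finally have "(\<Prod>a = 0..<card I. mat (card I) (card I) (\<lambda>(a, b). indet (card I - a) (column I b)) $$ (a, p a))
        = Poly_Mapping.single (term_exp I p) (1::complex)" .
    moreover have "signof p * Poly_Mapping.single (term_exp I p) (1::complex)
        = Poly_Mapping.single (term_exp I p) (signof p)"
      by (simp add: sign_def single_uminus)
    ultimately show "signof p * (\<Prod>a = 0..<card I. mat (card I) (card I) (\<lambda>(a, b). indet (card I - a) (column I b)) $$ (a, p a))
        = Poly_Mapping.single (term_exp I p) (signof p)"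
      by simp
  qed
  finally show ?thesis .
qed

lemma term_exp_rev: "term_exp I (rev_perm (card I)) = path_exp I"
proof -
  have "term_exp I (rev_perm (card I)) = (\<Sum>b<card I. Poly_Mapping.single (Suc b, column I b) 1)"
    unfolding term_exp_def
    by (rule sum.reindex_bij_witness[of _ "\<lambda>b. card I - Suc b" "\<lambda>b. card I - Suc b"])
      (auto simp: rev_perm_def Suc_diff_Suc)
  also have "\<dots> = (\<Sum>b<card I. Poly_Mapping.single (card (I \<inter> {1..column I b}), column I b) 1)"
    by (rule sum.cong) (simp_all add: card_upto_column[OF I] del: One_nat_def)
  also have "\<dots> = path_exp I"
    unfolding path_exp_def
    by (rule sum.reindex_bij_betw[OF column_bij[OF I], of "\<lambda>j. Poly_Mapping.single (card (I \<inter> {1..j}), j) 1"])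
  finally show ?thesis .
qed

lemma keys_minor:
  assumes "e \<in> keys (minor m I)"
  obtains p where "p permutes {0..<card I}" "e = term_exp I p"
proof -
  have "lookup (minor m I) e \<noteq> 0" using assms by (simp add: in_keys_iff)
  then obtain p where "p permutes {0..<card I}" "lookup (Poly_Mapping.single (term_exp I p) (signof p :: complex)) e \<noteq> 0"
    unfolding minor_leibniz lookup_sum by (metis (no_types, lifting) mem_Collect_eq sum.neutral)
  with that show ?thesis by (auto simp: lookup_single when_def split: if_splits)
qed

lemma wt_term_exp_less:
  assumes "p permutes {0..<card I}" "p \<noteq> rev_perm (card I)"
  shows "wt prodwt (term_exp I p) < wt prodwt (path_exp I)"
  unfolding term_exp_rev[symmetric] term_exp_def wt_sum
  using rearrangement_strict[of "card I" "\<lambda>b. int (column I b)" p] column_less[OF I] assms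
  by simp

text \<open>Every Leibniz term except that of the reversal has strictly smaller weight and so cannot
  meet \<open>path_exp I\<close>, whose coefficient is thus the sign of the reversal.\<close>

lemma lead_minor: "lead prodwt (minor m I) (path_exp I)"
  unfolding lead_def
proof (intro conjI ballI impI)
  have "lookup (minor m I) (path_exp I)
      = (\<Sum>p | p permutes {0..<card I}. if p = rev_perm (card I) then signof p else 0)"
    unfolding minor_leibniz lookup_sum
  proof (rule sum.cong[OF refl])
    fix p assume "p \<in> {p. p permutes {0..<card I}}"
    then show "lookup (Poly_Mapping.single (term_exp I p) (signof p)) (path_exp I)
        = (if p = rev_perm (card I) then signof p else (0::complex))"
      using wt_term_exp_less[of p]
      by (cases "p = rev_perm (card I)") (auto simp: lookup_single when_def term_exp_rev)
  qed
  also have "\<dots> = signof (rev_perm (card I))"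
    by (subst sum.delta) (simp_all add: finite_permutations rev_perm_permutes)
  also have "\<dots> \<noteq> 0" by (simp add: sign_def)
  finally show "lookup (minor m I) (path_exp I) \<noteq> 0" .
next
  fix e assume e: "e \<in> keys (minor m I)" "e \<noteq> path_exp I"
  then obtain p where "p permutes {0..<card I}" "e = term_exp I p" using keys_minor by blast
  then show "wt prodwt e < wt prodwt (path_exp I)"
    using wt_term_exp_less[of p] e term_exp_rev by auto
qed

lemma row_homogeneous_minor: "row_homogeneous m (\<lambda>r. of_bool (1 \<le> r \<and> r \<le> card I)) (minor m I)"
  unfolding row_homogeneous_def
proof (intro ballI conjI allI)
  fix e assume "e \<in> keys (minor m I)"
  then obtain p where p: "p permutes {0..<card I}" "e = term_exp I p" using keys_minor by blast
  have col: "column I (p a) \<in> {1..m}" if "a < card I" for a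
    using that permutes_in_image[OF p(1), of a] column_in[OF I, of "p a"] I by auto
  show "keys e \<subseteq> {1..m} \<times> {1..m}"
  proof
    fix x assume x: "x \<in> keys e"
    obtain a where a: "a < card I" "x \<in> keys (Poly_Mapping.single (card I - a, column I (p a)) (1::nat))"
      using x unfolding p(2) term_exp_def in_keys_iff lookup_sum by (metis (no_types, lifting) lessThan_iff sum.neutral)
    then show "x \<in> {1..m} \<times> {1..m}"
      using col[OF a(1)] card_le_m[OF I] by auto
  qed
  fix r
  have "rowdeg m r e = (\<Sum>a<card I. of_bool (card I - a = r))"
    unfolding p(2) term_exp_def rowdeg_sum by (rule sum.cong) (use col in \<open>simp_all add: rowdeg_single del: One_nat_def\<close>)
  \<comment> \<open>As \<open>a < card I\<close>, the difference \<open>card I - a\<close> is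
    positive and row 0 is never hit; any other row up to \<open>card I\<close> is hit exactly at
    \<open>card I - r\<close>.\<close>
  also have "\<dots> = (\<Sum>a<card I. if a = card I - r then of_bool (1 \<le> r \<and> r \<le> card I) else 0)"
    by (rule sum.cong) auto
  also have "\<dots> = of_bool (1 \<le> r \<and> r \<le> card I)" by (subst sum.delta) auto
  finally show "rowdeg m r e = of_bool (1 \<le> r \<and> r \<le> card I)" .
qed

lemma subst_minor:
  "subst v (minor m I) = det (mat (card I) (card I) (\<lambda>(a, b). v (card I - a, column I b)))"
  unfolding minor_eq[OF I] subst.hom_det[symmetric] by (rule arg_cong[where f = det], rule eq_matI) auto

text \<open>The rows of a minor are \<open>1\<close> to \<open>card I\<close> without gaps. If row
  \<open>r + 1\<close> is among them, so is row \<open>r\<close>, and adding one row to another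
  keeps the determinant; otherwise the operation changes no entry of the submatrix.\<close>

lemma row_invariant_minor: "row_invariant (minor m I)"
  unfolding row_invariant_def
proof (intro allI impI)
  fix r v assume r: "1 \<le> (r::nat)"
  let ?k = "card I"
  let ?M = "\<lambda>v. mat ?k ?k (\<lambda>(a, b). v (?k - a, column I b)) :: cpoly mat"
  show "subst (row_op r v) (minor m I) = subst v (minor m I)"
  proof (cases "Suc r \<le> ?k")
    case True
    have "?M (row_op r v) = addrow 1 (?k - Suc r) (?k - r) (?M v)"
    proof (rule eq_matI)
      fix a b assume "a < dim_row (addrow 1 (?k - Suc r) (?k - r) (?M v))"
        "b < dim_col (addrow 1 (?k - Suc r) (?k - r) (?M v))"
      then have ab: "a < ?k" "b < ?k" by auto
      have "?k - a = Suc r \<longleftrightarrow> ?k - Suc r = a" using ab True by auto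
      then show "?M (row_op r v) $$ (a, b) = addrow 1 (?k - Suc r) (?k - r) (?M v) $$ (a, b)"
        using ab True r by (auto simp: mat_addrow_def row_op_def)
    qed auto
    moreover have "det (addrow 1 (?k - Suc r) (?k - r) (?M v)) = det (?M v)"
      by (rule det_addrow[where n = ?k]) (use r True in auto)
    ultimately show ?thesis by (simp add: subst_minor)
  next
    case False
    have "?M (row_op r v) = ?M v"
      by (rule eq_matI) (use False in \<open>auto simp: row_op_def\<close>)
    then show ?thesis by (simp add: subst_minor)
  qed
qed

end

section \<open>Top exponents of row-invariant polynomials\<close>

text \<open>Indicator weights turn the weight bound for substitutions into a count of factors. It is
  used to trace from which places of \<open>e\<close> the factors of a substituted monomial can
  come.\<close>

lemma keys_subst_mon_le:
  assumes "finite S" "finite S'"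
    and v: "\<And>x k. lookup e x \<noteq> 0 \<Longrightarrow> k \<in> keys (v x) \<Longrightarrow> (\<Sum>y\<in>S. lookup k y) \<le> of_bool (x \<in> S')"
    and k: "k \<in> keys (subst_mon v e)"
  shows "(\<Sum>y\<in>S. lookup k y) \<le> (\<Sum>x\<in>S'. lookup e x)"
proof -
  have "wt (\<lambda>y. of_bool (y \<in> S)) k \<le> wt (\<lambda>x. of_bool (x \<in> S')) e"
  proof (rule keys_subst_mon_wt_le[OF _ k])
    fix x k assume "lookup e x \<noteq> 0" "k \<in> keys (v x)"
    from v[OF this] have "int (\<Sum>y\<in>S. lookup k y) \<le> of_bool (x \<in> S')"
      by (cases "x \<in> S'") (auto simp del: of_nat_sum)
    then show "wt (\<lambda>y. of_bool (y \<in> S)) k \<le> of_bool (x \<in> S')" using assms by (simp add: wt_indicator)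
  qed
  then have "int (\<Sum>y\<in>S. lookup k y) \<le> int (\<Sum>x\<in>S'. lookup e x)"
    using assms by (simp add: wt_indicator)
  then show ?thesis by linarith
qed

text \<open>The same count with negated indicators, so that an upper bound on weights becomes a
  lower bound on degrees.\<close>

lemma keys_subst_mon_ge:
  assumes "finite S" "finite S'"
    and v: "\<And>x k. lookup e x \<noteq> 0 \<Longrightarrow> k \<in> keys (v x) \<Longrightarrow> of_bool (x \<in> S') \<le> (\<Sum>y\<in>S. lookup k y)"
    and k: "k \<in> keys (subst_mon v e)"
  shows "(\<Sum>x\<in>S'. lookup e x) \<le> (\<Sum>y\<in>S. lookup k y)"
proof -
  have neg: "wt (\<lambda>y. - u y) k = - wt u k" for u and k :: expo
    by (simp add: wt_def sum_negf)
  have "wt (\<lambda>y. - of_bool (y \<in> S)) k \<le> wt (\<lambda>x. - of_bool (x \<in> S')) e"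
  proof (rule keys_subst_mon_wt_le[OF _ k])
    fix x k assume "lookup e x \<noteq> 0" "k \<in> keys (v x)"
    from v[OF this] have "of_bool (x \<in> S') \<le> int (\<Sum>y\<in>S. lookup k y)" 
      by (cases "x \<in> S'") (auto simp del: of_nat_sum)
    then show "wt (\<lambda>y. - of_bool (y \<in> S)) k \<le> - of_bool (x \<in> S')" using assms by (simp add: wt_indicator neg)
  qed
  then have "int (\<Sum>x\<in>S'. lookup e x) \<le> int (\<Sum>y\<in>S. lookup k y)"
    using assms by (simp add: wt_indicator neg)
  then show ?thesis by linarith
qed

lemma lookup_const_mult: "lookup (const c * p) k = c * lookup p k"
proof -
  have "const c * p = Poly_Mapping.map ((*) c) p"
    by (simp add: const_def mult_map_scale_conv_mult)
  then show ?thesis by (simp add: Poly_Mapping.map.rep_eq when_def)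
qed

lemma lookup_subst: "lookup (subst v f) k = (\<Sum>e\<in>keys f. lookup f e * lookup (subst_mon v e) k)"
  by (simp add: subst_def lookup_sum lookup_const_mult)

lemma keys_indet [simp]: "keys (indet i j) = {Poly_Mapping.single (i, j) 1}"
  by (simp add: indet_def)

lemma keys_indet_add: "k \<in> keys (indet i j + indet i' j') \<Longrightarrow>
    k = Poly_Mapping.single (i, j) 1 \<or> k = Poly_Mapping.single (i', j') 1"
  using keys_add[of "indet i j" "indet i' j'"] by auto

lemma lead_indet: "lead u (indet i j) (Poly_Mapping.single (i, j) 1)"
  by (simp add: lead_def indet_def)

lemma lead_indet_add:
  assumes "u (i', j') < u (i, j)"
  shows "lead u (indet i j + indet i' j') (Poly_Mapping.single (i, j) 1)"
  unfolding lead_def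
proof (intro conjI ballI impI)
  have "(i', j') \<noteq> (i, j)" using assms by auto
  then show "lookup (indet i j + indet i' j') (Poly_Mapping.single (i, j) 1) \<noteq> 0"
    by (auto simp: indet_def lookup_add lookup_single when_def)
  fix k assume "k \<in> keys (indet i j + indet i' j')" "k \<noteq> Poly_Mapping.single (i, j) 1"
  with keys_indet_add[OF this(1)] show "wt u k < wt u (Poly_Mapping.single (i, j) 1)"
    using assms by auto
qed

text \<open>Used with e as the exponent matrix of a semistandard tableau: the entry at (r, i) is then the
  number of entries i in row r, and the sum counts the entries of row r that are at most J.\<close>

definition psum :: "nat \<Rightarrow> nat \<Rightarrow> expo \<Rightarrow> nat" where
  "psum r J e = (\<Sum>i=1..J. lookup e (r, i))"

lemma psum_superset:
  assumes "keys e \<subseteq> {1..m} \<times> {1..m}" "m \<le> K"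
  shows "psum r K e = rowdeg m r e"
  unfolding psum_def rowdeg_def
proof (rule sum.mono_neutral_right)
  show "\<forall>i\<in>{1..K} - {1..m}. lookup e (r, i) = 0"
  proof
    fix i assume "i \<in> {1..K} - {1..m}"
    then have "(r, i) \<notin> keys e" using assms(1) by auto
    then show "lookup e (r, i) = 0" by (simp add: in_keys_iff)
  qed
qed (use assms in auto)

lemma wt_box:
  assumes "keys e \<subseteq> {1..m} \<times> {1..m}"
  shows "wt prodwt e = (\<Sum>k=1..m. \<Sum>i=1..m. int k * int i * int (lookup e (k, i)))"
  by (subst wt_superset[OF _ assms]) (simp_all add: sum.cartesian_product case_prod_unfold)

context
  fixes m r j :: nat and d :: "nat \<Rightarrow> nat" and f :: cpoly and M :: expo
  assumes hom: "row_homogeneous m d f" and inv: "row_invariant f" and r: "1 \<le> r" and j: "1 \<le> j"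
    and M: "M \<in> keys f" and top: "\<And>e. e \<in> keys f \<Longrightarrow> wt prodwt e \<le> wt prodwt M"
begin

text \<open>A row operation turns the first substitution into the second, so both have the same effect on
  f. The exponent \<open>target\<close> below is M with the entry at (r + 1, j) moved to (r, j). Since M has
  maximal weight, no other exponent of f contributes to it in the second substitution; in the first one
  it can occur only if the inequality for M and j holds.\<close>

definition generic1 :: "nat \<times> nat \<Rightarrow> cpoly" where
  "generic1 = (\<lambda>(k, i).
     if k = r then (if i < j then indet r i + indet (Suc r) i else indet r i)
     else if k = Suc r then (if i < j then - indet r i else if i = j then 0 else indet (Suc r) i)
     else indet k i)"

definition generic2 :: "nat \<times> nat \<Rightarrow> cpoly" where
  "generic2 = (\<lambda>(k, i).
     if k = r then (if i < j then indet r i + indet (Suc r) i else indet r i)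
     else if k = Suc r then
       (if i < j then indet (Suc r) i else if i = j then indet r i else indet (Suc r) i + indet r i)
     else indet k i)"

lemma row_op_generic1: "row_op r generic1 = generic2"
  by (auto simp: fun_eq_iff row_op_def generic1_def generic2_def)

definition moved :: "nat \<times> nat \<Rightarrow> nat \<times> nat" where
  "moved x = (if x = (Suc r, j) then (r, j) else x)"

definition target :: expo where
  "target = (\<Sum>x\<in>keys M. \<Sum>i<lookup M x. Poly_Mapping.single (moved x) 1)"

lemma lookup_target: "lookup target y = (\<Sum>x\<in>keys M. if moved x = y then lookup M x else 0)"
  unfolding target_def lookup_sum lookup_single when_def by (intro sum.cong) auto

lemma target_other: "y \<noteq> (r, j) \<Longrightarrow> y \<noteq> (Suc r, j) \<Longrightarrow> lookup target y = lookup M y"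
proof -
  assume y: "y \<noteq> (r, j)" "y \<noteq> (Suc r, j)"
  then have "lookup target y = (\<Sum>x\<in>keys M. if x = y then lookup M x else 0)"
    unfolding lookup_target by (intro sum.cong) (auto simp: moved_def)
  then show ?thesis by (simp add: in_keys_iff)
qed

lemma target_j: "lookup target (r, j) = lookup M (r, j) + lookup M (Suc r, j)" "lookup target (Suc r, j) = 0"
proof -
  have "lookup target (r, j) = (\<Sum>x\<in>keys M. (if x = (r, j) then lookup M x else 0) + (if x = (Suc r, j) then lookup M x else 0))"
    unfolding lookup_target by (intro sum.cong) (auto simp: moved_def)
  then show "lookup target (r, j) = lookup M (r, j) + lookup M (Suc r, j)"
    by (simp add: sum.distrib in_keys_iff)
  show "lookup target (Suc r, j) = 0"
    unfolding lookup_target by (intro sum.neutral) (auto simp: moved_def)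
qed

lemma keys_in_box: "e \<in> keys f \<Longrightarrow> keys e \<subseteq> {1..m} \<times> {1..m}"
  and rowdeg_eq: "e \<in> keys f \<Longrightarrow> rowdeg m k e = d k"
  using hom by (auto simp: row_homogeneous_def)

text \<open>In each binomial of \<open>generic2\<close> the auxiliary weight \<open>u\<close>
  prefers the indeterminate at \<open>moved x\<close>. So \<open>target\<close> is a leading
  exponent, and its coefficient cannot cancel.\<close>

lemma target_generic2: "lookup (subst_mon generic2 M) target \<noteq> 0"
proof -
  define u :: "nat \<times> nat \<Rightarrow> int" where
    "u = (\<lambda>(k, i). of_bool (k = r \<and> i < j \<or> k = Suc r \<and> j < i))"
  have "lead u (generic2 x) (Poly_Mapping.single (moved x) 1)" for x
    unfolding generic2_def moved_def u_def
    by (cases x) (auto intro!: lead_indet lead_indet_add simp del: One_nat_def)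
  then have "lead u (subst_mon generic2 M) target"
    unfolding target_def by (intro lead_subst_mon)
  then show ?thesis by (simp add: lead_def)
qed

text \<open>An exponent that yields \<open>target\<close> can differ from \<open>M\<close> only by
  transfers within columns between the rows \<open>r\<close> and \<open>r + 1\<close>: upwards to
  the right of \<open>j\<close>, downwards to the left. With fixed row degrees a proper change of
  this kind raises the weight, which is already maximal at \<open>M\<close>.\<close>

lemma only_top:
  assumes e: "e \<in> keys f" and t: "target \<in> keys (subst_mon generic2 e)"
  shows "e = M"
proof -
  note le = keys_subst_mon_le[OF _ _ _ t] and ge = keys_subst_mon_ge[OF _ _ _ t]
  have other: "lookup e (k, i) = lookup M (k, i)" if "k \<noteq> r" "k \<noteq> Suc r" for k i
  proof -
    have "lookup target (k, i) \<le> lookup e (k, i)"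
      using le[of "{(k, i)}" "{(k, i)}"] that
      by (fastforce simp: generic2_def lookup_single when_def dest!: keys_indet_add split: if_splits)
    moreover have "lookup e (k, i) \<le> lookup target (k, i)"
      using ge[of "{(k, i)}" "{(k, i)}"] that
      by (fastforce simp: generic2_def lookup_single when_def dest!: keys_indet_add split: if_splits)
    ultimately show ?thesis using that target_other[of "(k, i)"] by simp
  qed
  have col: "lookup e (r, i) + lookup e (Suc r, i) = lookup M (r, i) + lookup M (Suc r, i)" for i
  proof -
    have "lookup target (r, i) + lookup target (Suc r, i) \<le> lookup e (r, i) + lookup e (Suc r, i)"
      using le[of "{(r, i), (Suc r, i)}" "{(r, i), (Suc r, i)}"]
      by (fastforce simp: generic2_def lookup_single when_def dest!: keys_indet_add split: if_splits)
    moreover have "lookup e (r, i) + lookup e (Suc r, i) \<le> lookup target (r, i) + lookup target (Suc r, i)"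
      using ge[of "{(r, i), (Suc r, i)}" "{(r, i), (Suc r, i)}"]
      by (fastforce simp: generic2_def lookup_single when_def dest!: keys_indet_add split: if_splits)
    moreover have "lookup target (r, i) + lookup target (Suc r, i) = lookup M (r, i) + lookup M (Suc r, i)"
      by (cases "i = j") (simp_all add: target_j target_other)
    ultimately show ?thesis by simp
  qed
  have high: "lookup M (Suc r, i) \<le> lookup e (Suc r, i)" if "j < i" for i
    using le[of "{(Suc r, i)}" "{(Suc r, i)}"] that target_other[of "(Suc r, i)"]
    by (fastforce simp: generic2_def lookup_single when_def dest!: keys_indet_add split: if_splits)
  have low: "lookup e (Suc r, i) \<le> lookup M (Suc r, i)" if "i < j" for i
    using ge[of "{(Suc r, i)}" "{(Suc r, i)}"] that target_other[of "(Suc r, i)"]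
    by (fastforce simp: generic2_def lookup_single when_def dest!: keys_indet_add split: if_splits)
  \<comment> \<open>\<open>D i\<close> is what column \<open>i\<close> transfers from row
    \<open>r\<close> to row \<open>r + 1\<close>. As the two row numbers differ by one, it changes
    the weight by \<open>i * D i\<close>.\<close>
  define D where "D i = int (lookup e (Suc r, i)) - int (lookup M (Suc r, i))" for i
  have rD: "int (lookup e (r, i)) - int (lookup M (r, i)) = - D i" for i
    using col[of i] by (simp add: D_def)
  have sumD: "(\<Sum>i=1..m. D i) = 0"
    using rowdeg_eq[OF e, of "Suc r"] rowdeg_eq[OF M, of "Suc r"]
    unfolding D_def sum_subtractf rowdeg_def by (simp flip: of_nat_sum)
  have "wt prodwt e - wt prodwt M
      = (\<Sum>k=1..m. \<Sum>i=1..m. int k * int i * (int (lookup e (k, i)) - int (lookup M (k, i))))"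
    by (simp add: wt_box[OF keys_in_box[OF e]] wt_box[OF keys_in_box[OF M]] right_diff_distrib flip: sum_subtractf)
  also have "\<dots> = (\<Sum>k\<in>{1..m} \<inter> {r, Suc r}. \<Sum>i=1..m. int k * int i * (int (lookup e (k, i)) - int (lookup M (k, i))))"
    by (rule sum.mono_neutral_right) (auto simp: other intro!: sum.neutral)
  also have "\<dots> \<ge> (\<Sum>i=1..m. int i * D i)" if "Suc r \<le> m"
  proof -
    have "{1..m} \<inter> {r, Suc r} = {r, Suc r}" using that r by auto
    then have "(\<Sum>k\<in>{1..m} \<inter> {r, Suc r}. \<Sum>i=1..m. int k * int i * (int (lookup e (k, i)) - int (lookup M (k, i))))
        = (\<Sum>i=1..m. int r * int i * (- D i)) + (\<Sum>i=1..m. int (Suc r) * int i * D i)"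
      by (simp add: rD D_def[symmetric])
    also have "\<dots> = (\<Sum>i=1..m. int i * D i)"
      unfolding sum.distrib[symmetric] by (rule sum.cong) (simp_all add: algebra_simps)
    finally show ?thesis by simp
  qed
  finally have wtD: "(\<Sum>i=1..m. int i * D i) \<le> 0" if "Suc r \<le> m"
    using that top[OF e] by simp
  have D0: "D i = 0" for i
  proof (cases "Suc r \<le> m \<and> i \<in> {1..m}")
    case False
    then have "(Suc r, i) \<notin> keys e" "(Suc r, i) \<notin> keys M" using keys_in_box[OF e] keys_in_box[OF M] by auto
    then show ?thesis by (simp add: D_def in_keys_iff)
  next
    case True
    \<comment> \<open>The signs of \<open>D\<close> make every \<open>(i - j) * D i\<close>
      nonnegative. Since the \<open>D i\<close> add up to 0, replacing \<open>i\<close> by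
      \<open>i - j\<close> does not change the weighted sum, which is at most 0. So all terms
      vanish, and \<open>D j\<close> does because the total is 0.\<close>
    have nonneg: "0 \<le> (int i - int j) * D i" for i
      using high[of i] low[of i] unfolding D_def
      by (cases i j rule: linorder_cases) (auto intro: mult_nonneg_nonneg mult_nonpos_nonpos)
    have "(\<Sum>i=1..m. (int i - int j) * D i) = (\<Sum>i=1..m. int i * D i) - int j * (\<Sum>i=1..m. D i)"
      by (simp add: left_diff_distrib sum_subtractf sum_distrib_left)
    then have "(\<Sum>i=1..m. (int i - int j) * D i) \<le> 0" using sumD wtD True by simp
    then have "(\<Sum>i=1..m. (int i - int j) * D i) = 0"
      using sum_nonneg[of "{1..m}" "\<lambda>i. (int i - int j) * D i"] nonneg by (metis antisym)
    then have "\<forall>i\<in>{1..m}. (int i - int j) * D i = 0"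
      using nonneg by (subst (asm) sum_nonneg_eq_0_iff) auto
    then have ne: "D i = 0" if "i \<in> {1..m}" "i \<noteq> j" for i
      using that by auto
    have "D i = (\<Sum>i=1..m. D i)" if "i = j"
      using ne True that by (subst sum.remove[of _ j]) (auto intro!: sum.neutral)
    then show ?thesis using ne True sumD by (cases "i = j") auto
  qed
  show "e = M"
  proof (rule poly_mapping_eqI)
    fix x :: "nat \<times> nat"
    obtain k i where x: "x = (k, i)" by force
    show "lookup e x = lookup M x"
      using other[of k i] D0[of i] rD[of i] unfolding x D_def by (cases "k = r"; cases "k = Suc r") auto
  qed
qed

text \<open>Some \<open>e\<close> in \<open>f\<close> yields \<open>target\<close> under
  \<open>generic1\<close>. There the factors of \<open>target\<close> in row \<open>r + 1\<close>
  left of \<open>j\<close>, at \<open>(r, j)\<close>, and in row \<open>r\<close> right of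
  \<open>j\<close> can come only from row \<open>r\<close> of \<open>e\<close>, in the same column.
  Their number is at most the degree of that row, which is also the degree of row \<open>r\<close>
  of \<open>M\<close>; cancelling the common entries leaves the inequality.\<close>

lemma top_interlace_pos: "psum (Suc r) j M \<le> psum r (j - 1) M"
proof -
  have "lookup (subst generic2 f) target = (\<Sum>e\<in>{M}. lookup f e * lookup (subst_mon generic2 e) target)"
    unfolding lookup_subst using M only_top
    by (intro sum.mono_neutral_right) (auto simp: in_keys_iff)
  also have "\<dots> \<noteq> 0" using target_generic2 M by (simp add: in_keys_iff)
  also have "subst generic2 f = subst generic1 f"
    using inv r unfolding row_op_generic1[symmetric] row_invariant_def by blast
  finally have "(\<Sum>e\<in>keys f. lookup f e * lookup (subst_mon generic1 e) target) \<noteq> 0"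
    by (simp add: lookup_subst)
  then obtain e where e: "e \<in> keys f" and "lookup f e * lookup (subst_mon generic1 e) target \<noteq> 0"
    by (rule sum.not_neutral_contains_not_neutral)
  then have t: "target \<in> keys (subst_mon generic1 e)" by (simp add: in_keys_iff)
  note le = keys_subst_mon_le[OF _ _ _ t]
  have ej: "lookup M (r, j) + lookup M (Suc r, j) \<le> lookup e (r, j)"
    using le[of "{(r, j)}" "{(r, j)}"] unfolding target_j[symmetric]
    by (fastforce simp: generic1_def lookup_single when_def dest!: keys_indet_add split: if_splits)
  have high: "lookup M (r, i) \<le> lookup e (r, i)" if "j < i" for i
    using le[of "{(r, i)}" "{(r, i)}"] that target_other[of "(r, i)"]
    by (fastforce simp: generic1_def lookup_single when_def dest!: keys_indet_add split: if_splits)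
  have low: "lookup M (Suc r, i) \<le> lookup e (r, i)" if "i < j" for i
    using le[of "{(Suc r, i)}" "{(r, i)}"] that target_other[of "(Suc r, i)"]
    by (fastforce simp: generic1_def lookup_single when_def dest!: keys_indet_add split: if_splits)
  \<comment> \<open>Here \<open>j\<close> may exceed \<open>m\<close>; the larger of the two covers
    the whole row and still allows a split at \<open>j\<close>.\<close>
  let ?K = "max j m"
  have split: "(\<Sum>i=1..?K. g i) = (\<Sum>i=1..j - 1. g i) + (g j + (\<Sum>i=Suc j..?K. g i))" for g :: "nat \<Rightarrow> nat"
  proof -
    have "{1..?K} = {1..j - 1} \<union> ({j} \<union> {Suc j..?K})" using j by auto
    moreover have "sum g ({1..j - 1} \<union> ({j} \<union> {Suc j..?K})) = sum g {1..j - 1} + sum g ({j} \<union> {Suc j..?K})"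
      by (rule sum.union_disjoint) (use j in auto)
    ultimately show ?thesis by simp
  qed
  have "psum r ?K e = psum r ?K M"
    using psum_superset[OF keys_in_box[OF e], of ?K r] psum_superset[OF keys_in_box[OF M], of ?K r] e M by (simp add: rowdeg_eq)
  then have "(\<Sum>i=1..j - 1. lookup e (r, i)) + (lookup e (r, j) + (\<Sum>i=Suc j..?K. lookup e (r, i)))
      = (\<Sum>i=1..j - 1. lookup M (r, i)) + (lookup M (r, j) + (\<Sum>i=Suc j..?K. lookup M (r, i)))"
    unfolding psum_def split .
  moreover have "(\<Sum>i=1..j - 1. lookup M (Suc r, i)) \<le> (\<Sum>i=1..j - 1. lookup e (r, i))"
    by (rule sum_mono) (use low in auto)
  moreover have "(\<Sum>i=Suc j..?K. lookup M (r, i)) \<le> (\<Sum>i=Suc j..?K. lookup e (r, i))"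
    by (rule sum_mono) (use high in auto)
  moreover have "psum (Suc r) j M = (\<Sum>i=1..j - 1. lookup M (Suc r, i)) + lookup M (Suc r, j)"
    using j unfolding psum_def by (cases j) auto
  ultimately show ?thesis using ej unfolding psum_def by linarith
qed

end

lemma top_interlace:
  assumes "row_homogeneous m d f" "row_invariant f" "1 \<le> r" "M \<in> keys f"
    and "\<And>e. e \<in> keys f \<Longrightarrow> wt prodwt e \<le> wt prodwt M"
  shows "psum (Suc r) J M \<le> psum r (J - 1) M"
  using top_interlace_pos[OF assms(1-3) _ assms(4,5)] by (cases "1 \<le> J") (auto simp: psum_def)

section \<open>Gelfand-Tsetlin patterns of exponents\<close>

lemma psum_add: "psum r J (e + e') = psum r J e + psum r J e'"
  by (simp add: psum_def lookup_add sum.distrib)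

lemma psum_zero [simp]: "psum r J 0 = 0"
  by (simp add: psum_def)

lemma psum_mono: "J \<le> K \<Longrightarrow> psum r J e \<le> psum r K e"
  unfolding psum_def by (rule sum_mono2) auto

lemma psum_Suc: "psum r (Suc J) e = psum r J e + lookup e (r, Suc J)"
  by (simp add: psum_def)

text \<open>The exponent matrices of the semistandard tableaux (see \<open>psum\<close>) all of whose columns have
  the height of a selected sink. For \<open>J = 0\<close> the truncated subtraction is harmless, as both sums are
  empty.\<close>

definition ssyt :: "nat \<Rightarrow> (int \<times> int) set \<Rightarrow> expo \<Rightarrow> bool" where
  "ssyt m A e \<longleftrightarrow> keys e \<subseteq> {1..m} \<times> {1..m}
     \<and> (\<forall>r J. 1 \<le> r \<longrightarrow> psum (Suc r) J e \<le> psum r (J - 1) e)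
     \<and> (\<forall>r. 1 \<le> r \<longrightarrow> rowdeg m r e \<noteq> rowdeg m (Suc r) e \<longrightarrow> (int (m - r), int r) \<in> A)"

text \<open>The northwest corner of the cell is on the antidiagonal reached after
  \<open>x + y + 1\<close> steps. The entry counts the tableau columns whose paths have made at
  least \<open>y + 1\<close> north steps by then. Cells with \<open>y < 0\<close> lie southeast of
  all paths and get the number of nonempty columns, the degree of row 1.\<close>

definition exp_pattern :: "nat \<Rightarrow> (int \<times> int) set \<Rightarrow> expo \<Rightarrow> int \<times> int \<Rightarrow> real" where
  "exp_pattern m A e = (\<lambda>(x, y).
     if (x, y) \<in> cells A then
       if y < 0 then real (rowdeg m 1 e) else real (psum (nat (y + 1)) (nat (x + y + 1)) e)
     else 0)"

lemma node_nonneg: "(x, y) \<in> nodes A \<Longrightarrow> 0 \<le> x \<and> 0 \<le> y"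
  by (auto simp: nodes_def)

lemma node_down: "(x, y) \<in> nodes A \<Longrightarrow> 0 \<le> x' \<Longrightarrow> x' \<le> x \<Longrightarrow> 0 \<le> y' \<Longrightarrow> y' \<le> y \<Longrightarrow> (x', y') \<in> nodes A"
proof -
  assume xy: "(x, y) \<in> nodes A" and le: "0 \<le> x'" "x' \<le> x" "0 \<le> y'" "y' \<le> y"
  from xy obtain a b where "(a, b) \<in> A" "x \<le> a" "y \<le> b" by (auto simp: nodes_def)
  moreover from this le have "x' \<le> a" "y' \<le> b" by simp_all
  ultimately show ?thesis using le by (auto simp: nodes_def intro!: bexI[of _ "(a, b)"])
qed

lemma cell_bounds:
  assumes "(x, y) \<in> cells A"
  shows "- 1 \<le> x" "- 1 \<le> y" "x = - 1 \<Longrightarrow> 0 \<le> y" "y = - 1 \<Longrightarrow> 0 \<le> x"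
  using assms by (auto simp: cells_def dest: node_nonneg)

lemma edge_horizontal: "{(x, y), (x + 1, y)} \<notin> edges A \<Longrightarrow> (x, y) \<notin> nodes A \<or> (x + 1, y) \<notin> nodes A"
  by (auto simp: edges_def)

lemma edge_vertical: "{(x, y), (x, y + 1)} \<notin> edges A \<Longrightarrow> (x, y) \<notin> nodes A \<or> (x, y + 1) \<notin> nodes A"
  by (auto simp: edges_def)

context
  fixes m :: nat and A :: "(int \<times> int) set" and e :: expo
  assumes A: "partial_staircase m A" and e: "ssyt m A e"
begin

lemma ssyt_box: "keys e \<subseteq> {1..m} \<times> {1..m}"
  and ssyt_interlace: "1 \<le> r \<Longrightarrow> psum (Suc r) J e \<le> psum r (J - 1) e"
  and ssyt_sink: "1 \<le> r \<Longrightarrow> rowdeg m r e \<noteq> rowdeg m (Suc r) e \<Longrightarrow> (int (m - r), int r) \<in> A"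
  using e by (auto simp: ssyt_def)

lemma psum_le_rowdeg: "psum r J e \<le> rowdeg m r e"
  using psum_mono[of J "max J m" r e] psum_superset[OF ssyt_box, of "max J m" r] by simp

text \<open>Entries increase strictly along columns, so row \<open>r\<close> holds none below
  \<open>r\<close>. This produces the zeros in the cells west of the staircase.\<close>

lemma psum_eq_0: "1 \<le> r \<Longrightarrow> J < r \<Longrightarrow> psum r J e = 0"
proof (induction r arbitrary: J)
  case (Suc r)
  show ?case
  proof (cases "r = 0")
    case True
    then show ?thesis using Suc by (simp add: psum_def)
  next
    case False
    then show ?thesis using Suc.IH[of "J - 1"] Suc.prems ssyt_interlace[of r J] by simp
  qed
qed simp

lemma psum_chain: "1 \<le> r \<Longrightarrow> psum (r + k) J e \<le> psum r (J - k) e"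
proof (induction k arbitrary: J)
  case (Suc k)
  have "psum (r + Suc k) J e \<le> psum (r + k) (J - 1) e"
    using ssyt_interlace[of "r + k" J] Suc.prems by simp
  also have "\<dots> \<le> psum r (J - 1 - k) e" using Suc by blast
  finally show ?case by simp
qed simp

text \<open>In columns as high as the next selected sink, which has height b, strictness leaves no room for an
  entry above m - (b - r) in row r.\<close>

lemma psum_full:
  assumes "1 \<le> r" "- 1 \<le> x" "(x + 1, int r) \<notin> nodes A"
  shows "psum r (nat (x + int r)) e = rowdeg m r e"
  using assms
proof (induction "Suc m - r" arbitrary: r)
  case 0
  then have "rowdeg m r e = 0"
    using ssyt_box by (fastforce simp: rowdeg_def in_keys_iff)
  then show ?case using psum_le_rowdeg[of r "nat (x + int r)"] by simp
next
  case (Suc k)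
  then have rm: "r \<le> m" by simp
  show ?case
  proof (cases "(int (m - r), int r) \<in> A")
    case True
    then have "\<not> x + 1 \<le> int (m - r)" using Suc.prems unfolding nodes_def by fastforce
    then have "m \<le> nat (x + int r)" using rm by simp
    then show ?thesis by (rule psum_superset[OF ssyt_box])
  next
    case False
    then have eq: "rowdeg m r e = rowdeg m (Suc r) e" using ssyt_sink Suc.prems by blast
    have "(x + 1, int (Suc r)) \<notin> nodes A"
      using Suc.prems node_down[of "x + 1" "int (Suc r)" A "x + 1" "int r"] by auto
    then have "psum (Suc r) (nat (x + int (Suc r))) e = rowdeg m r e"
      using Suc.hyps(1)[of "Suc r"] Suc.hyps(2) Suc.prems eq by simp
    moreover have "nat (x + int (Suc r)) - 1 = nat (x + int r)" using Suc.prems by simp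
    ultimately have "rowdeg m r e \<le> psum r (nat (x + int r)) e"
      using ssyt_interlace[of r "nat (x + int (Suc r))"] Suc.prems by simp
    then show ?thesis using psum_le_rowdeg antisym by blast
  qed
qed

lemma psum_full_int:
  assumes "0 \<le> y" "- 1 \<le> x" "(x + 1, y + 1) \<notin> nodes A"
  shows "psum (nat (y + 1)) (nat (x + y + 1)) e = rowdeg m (nat (y + 1)) e"
  using psum_full[of "nat (y + 1)" x] assms by (simp add: algebra_simps)

lemma exp_pattern_row_mono:
  assumes "(x, y) \<in> cells A" "(x', y) \<in> cells A" "x \<le> x'"
  shows "exp_pattern m A e (x, y) \<le> exp_pattern m A e (x', y)"
  using assms by (auto simp: exp_pattern_def intro!: psum_mono)

lemma exp_pattern_col_mono:
  assumes c: "(x, y) \<in> cells A" "(x, y') \<in> cells A" "y' \<le> y"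
  shows "exp_pattern m A e (x, y) \<le> exp_pattern m A e (x, y')"
proof (cases "0 \<le> y'")
  case True
  have "psum (nat (y' + 1) + nat (y - y')) (nat (x + y + 1)) e \<le> psum (nat (y' + 1)) (nat (x + y + 1) - nat (y - y')) e"
    by (rule psum_chain) (use True in simp)
  moreover have "nat (y' + 1) + nat (y - y') = nat (y + 1)" using True c by simp
  moreover have "nat (x + y + 1) - nat (y - y') = nat (x + y' + 1)"
    using True c cell_bounds(1)[OF c(1)] by linarith
  ultimately show ?thesis using c True by (simp add: exp_pattern_def)
next
  case False
  then have y': "y' = - 1" using cell_bounds(2)[OF c(2)] by simp
  show ?thesis
  proof (cases "y < 0")
    case True
    then show ?thesis using c False by (simp add: exp_pattern_def)
  next
    case y: False
    have "psum (1 + nat y) (nat (x + y + 1)) e \<le> psum 1 (nat (x + y + 1) - nat y) e"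
      by (rule psum_chain) simp
    also have "\<dots> \<le> rowdeg m 1 e" by (rule psum_le_rowdeg)
    finally show ?thesis using c y y' by (simp add: exp_pattern_def nat_add_distrib)
  qed
qed

lemma exp_pattern_west: "(- 1, y) \<in> cells A \<Longrightarrow> exp_pattern m A e (- 1, y) = 0"
  using cell_bounds(3)[of "- 1" y A] psum_eq_0[of "nat (y + 1)" "nat y"] by (simp add: exp_pattern_def)

text \<open>For \<open>y \<ge> 0\<close>, the missing edge means that the northeast corner of the
  western cell is no node. Then this cell already counts the whole row, and going east adds
  nothing.\<close>

lemma exp_pattern_connected_east:
  assumes c: "(x, y) \<in> cells A" "(x + 1, y) \<in> cells A" and n: "{(x + 1, y), (x + 1, y + 1)} \<notin> edges A"
  shows "exp_pattern m A e (x, y) = exp_pattern m A e (x + 1, y)"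
proof (cases "0 \<le> y")
  case True
  have x: "- 1 \<le> x" using cell_bounds(1)[OF c(1)] .
  have "(x + 1, y + 1) \<notin> nodes A"
    using edge_vertical[OF n] node_down[of "x + 1" "y + 1" A "x + 1" y] True x by auto
  then have f: "psum (nat (y + 1)) (nat (x + y + 1)) e = rowdeg m (nat (y + 1)) e"
    using psum_full_int True x by blast
  have "psum (nat (y + 1)) (nat (x + y + 1)) e \<le> psum (nat (y + 1)) (nat (x + 1 + y + 1)) e"
    by (rule psum_mono) simp
  with f have "psum (nat (y + 1)) (nat (x + 1 + y + 1)) e = rowdeg m (nat (y + 1)) e"
    using psum_le_rowdeg antisym by metis
  then show ?thesis using c True f by (simp add: exp_pattern_def)
next
  case False
  then show ?thesis using c by (simp add: exp_pattern_def)
qed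

text \<open>East of the column \<open>x = -1\<close> both entries are full row degrees; for
  \<open>y = -1\<close> both are the degree of row 1. Otherwise the degrees could differ only if the
  sink of height \<open>y + 1\<close> were selected, and then the missing corner would be a node
  after all.\<close>

lemma exp_pattern_connected_north:
  assumes c: "(x, y) \<in> cells A" "(x, y + 1) \<in> cells A" and n: "{(x, y + 1), (x + 1, y + 1)} \<notin> edges A"
  shows "exp_pattern m A e (x, y) = exp_pattern m A e (x, y + 1)"
proof (cases "x = - 1")
  case True
  then show ?thesis using exp_pattern_west c by simp
next
  case False
  then have x: "0 \<le> x" and y: "- 1 \<le> y" using cell_bounds(1,2)[OF c(1)] by auto
  have out: "(x + 1, y + 1) \<notin> nodes A"
    using edge_horizontal[OF n] node_down[of "x + 1" "y + 1" A x "y + 1"] x y by auto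
  then have out': "(x + 1, y + 1 + 1) \<notin> nodes A"
    using node_down[of "x + 1" "y + 1 + 1" A "x + 1" "y + 1"] x y by auto
  have D: "psum (nat (y + 1 + 1)) (nat (x + (y + 1) + 1)) e = rowdeg m (nat (y + 1 + 1)) e"
    using psum_full_int[of "y + 1" x] x y out' by simp
  have above: "(x, y + 1 + 1) \<in> nodes A" using c(2) out by (auto simp: cells_def)
  show ?thesis
  proof (cases "0 \<le> y")
    case True
    have C: "psum (nat (y + 1)) (nat (x + y + 1)) e = rowdeg m (nat (y + 1)) e"
      using psum_full_int[of y x] x True out by simp
    have "rowdeg m (nat (y + 1)) e = rowdeg m (Suc (nat (y + 1))) e"
    proof (rule ccontr)
      assume "rowdeg m (nat (y + 1)) e \<noteq> rowdeg m (Suc (nat (y + 1))) e"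
      then have s: "(int (m - nat (y + 1)), y + 1) \<in> A"
        using ssyt_sink[of "nat (y + 1)"] True by simp
      obtain a b where ab: "(a, b) \<in> A" "x \<le> a" "y + 1 + 1 \<le> b"
        using above by (auto simp: nodes_def)
      then obtain k where "k \<le> m" "a = int (m - k)" "b = int k"
        using A by (auto simp: partial_staircase_def sinks_def)
      \<comment> \<open>From \<open>a + b = m\<close>, \<open>x \<le> a\<close> and
        \<open>y + 2 \<le> b\<close>, the selected sink of height \<open>y + 1\<close> has abscissa
        greater than \<open>x\<close>.\<close>
      with ab have "x + 1 \<le> int (m - nat (y + 1))" using True by auto
      with s have "(x + 1, y + 1) \<in> nodes A" using x y unfolding nodes_def by fastforce
      with out show False by simp
    qed
    moreover have "Suc (nat (y + 1)) = nat (y + 1 + 1)" using True by simp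
    ultimately show ?thesis using C D c True by (simp add: exp_pattern_def)
  next
    case False
    then have "y = - 1" using y by simp
    then show ?thesis using c D by (simp add: exp_pattern_def)
  qed
qed

lemma exp_pattern_GT: "exp_pattern m A e \<in> GT A"
  unfolding GT_def
proof (intro CollectI conjI allI ballI impI)
  fix C D assume "connected_cells A C D"
  then show "exp_pattern m A e C = exp_pattern m A e D"
    using exp_pattern_connected_east exp_pattern_connected_north
    by (cases C) (auto simp: connected_cells_def external_cells_def)
next
  fix y assume "(- 1, y) \<in> external_cells A"
  then show "exp_pattern m A e (- 1, y) = 0"
    using exp_pattern_west by (auto simp: external_cells_def)
qed (auto simp: exp_pattern_row_mono exp_pattern_col_mono, auto simp: exp_pattern_def)

lemma exp_pattern_int: "range (exp_pattern m A e) \<subseteq> \<int>"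
  by (auto simp: exp_pattern_def)

end

text \<open>The partial sums that no cell records are forced: they vanish for \<open>J < r\<close>,
  and beyond the nodes the row is already full.\<close>

lemma ssyt_eqI:
  assumes A: "partial_staircase m A" and e: "ssyt m A e" and e': "ssyt m A e'"
    and eq: "\<And>x y. (x, y) \<in> cells A \<Longrightarrow> 0 \<le> y \<Longrightarrow>
      psum (nat (y + 1)) (nat (x + y + 1)) e = psum (nat (y + 1)) (nat (x + y + 1)) e'"
  shows "e = e'"
proof -
  have ps: "psum r J e = psum r J e'" if r: "1 \<le> r" for r J
  proof (induction J)
    case 0
    then show ?case by (simp add: psum_def)
  next
    case (Suc J)
    define x where "x = int (Suc J) - int r"
    consider "Suc J < r" | "Suc J \<ge> r" "(x, int r) \<in> nodes A" | "Suc J \<ge> r" "(x, int r) \<notin> nodes A"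
      by linarith
    then show ?case
    proof cases
      case 1
      then show ?thesis using psum_eq_0[OF A e r, of "Suc J"] psum_eq_0[OF A e' r, of "Suc J"] by simp
    next
      case 2
      then have "(x, int r - 1) \<in> cells A" by (simp add: cells_def)
      from eq[OF this] show ?thesis using r by (simp add: x_def nat_add_distrib)
    next
      \<comment> \<open>The row is full one step earlier, at \<open>J\<close>, so the induction
        hypothesis at \<open>J\<close> settles \<open>Suc J\<close>.\<close>
      case 3
      have "psum r (nat (x - 1 + int r)) f = rowdeg m r f" if "ssyt m A f" for f
        by (rule psum_full[OF A that r]) (use 3 in \<open>simp_all add: x_def algebra_simps\<close>)
      then have full: "psum r J f = rowdeg m r f" if "ssyt m A f" for f
        using that by (simp add: x_def)
      have "psum r (Suc J) f = rowdeg m r f" if "ssyt m A f" for f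
        using full[OF that] psum_mono[of J "Suc J" r f] psum_le_rowdeg[OF A that, of r "Suc J"] by simp
      then show ?thesis using full e e' Suc by simp
    qed
  qed
  show ?thesis
  proof (rule poly_mapping_eqI)
    fix z :: "nat \<times> nat"
    obtain r j where z: "z = (r, j)" by force
    show "lookup e z = lookup e' z"
    proof (cases "1 \<le> r \<and> 1 \<le> j")
      case True
      then obtain J where "j = Suc J" by (cases j) auto
      then show ?thesis using ps[of r J] ps[of r "Suc J"] True by (simp add: z psum_Suc)
    next
      case False
      then have "z \<notin> keys e" "z \<notin> keys e'"
        using ssyt_box[OF A e] ssyt_box[OF A e'] by (auto simp: z)
      then show ?thesis by (simp add: in_keys_iff)
    qed
  qed
qed

section \<open>Exponents of tableaux\<close>

lemma path_point_eq: "path_point I t = (int t - int (card (I \<inter> {1..t})), int (card (I \<inter> {1..t})))"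
proof (induction t)
  case (Suc t)
  have "I \<inter> {1..Suc t} = (if Suc t \<in> I then insert (Suc t) (I \<inter> {1..t}) else I \<inter> {1..t})"
    by (auto simp: le_Suc_eq)
  with Suc show ?case by (auto simp: Let_def)
qed simp

lemma card_upto_less: "i < j \<Longrightarrow> j \<in> I \<Longrightarrow> card (I \<inter> {1..i}) < card (I \<inter> {1..j::nat})"
proof (rule psubset_card_mono)
  assume "i < j" "j \<in> I"
  then have "j \<in> I \<inter> {1..j}" "j \<notin> I \<inter> {1..i}" "I \<inter> {1..i} \<subseteq> I \<inter> {1..j}" by auto
  then show "I \<inter> {1..i} \<subset> I \<inter> {1..j}" by blast
qed simp

lemma psum_path_exp:
  assumes I: "I \<subseteq> {1..m}"
  shows "psum r J (path_exp I) = of_bool (\<exists>j\<in>I. j \<le> J \<and> card (I \<inter> {1..j}) = r)"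
proof (cases "\<exists>j\<in>I. j \<le> J \<and> card (I \<inter> {1..j}) = r")
  case True
  then obtain j where j: "j \<in> I" "j \<le> J" "card (I \<inter> {1..j}) = r" by blast
  have uniq: "i = j" if "i \<in> I" "card (I \<inter> {1..i}) = r" for i
    using card_upto_less[of i j I] card_upto_less[of j i I] j that by (cases i j rule: linorder_cases) auto
  have fin: "finite I" using I finite_subset by blast
  have "(i \<in> I \<and> card (I \<inter> {1..i}) = r) = (i = j)" for i
    using uniq j by blast
  then have "psum r J (path_exp I) = (\<Sum>i=1..J. if i = j then 1 else 0)"
    unfolding psum_def lookup_path_exp[OF fin] by (intro sum.cong) auto
  also have "\<dots> = 1" using j I by auto
  finally show ?thesis using True by simp
next
  case False
  have fin: "finite I" using I finite_subset by blast
  have "psum r J (path_exp I) = 0"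
    unfolding psum_def lookup_path_exp[OF fin] by (rule sum.neutral) (use False in auto)
  then show ?thesis using False by simp
qed

text \<open>For \<open>y \<ge> 0\<close> the cell is southeast of the path iff the north step to
  height \<open>y + 1\<close> is among the first \<open>x + y + 1\<close> steps, that is, iff at
  most \<open>x\<close> east steps precede it.\<close>

lemma path_pattern_eq:
  assumes I: "I \<subseteq> {1..m}" and c: "(x, y) \<in> cells A"
  shows "path_pattern m A I (x, y) =
    (if y < 0 then 1 else real (psum (nat (y + 1)) (nat (x + y + 1)) (path_exp I)))"
proof (cases "y < 0")
  case True
  then have "y = - 1" "0 \<le> x" using cell_bounds(2,4)[OF c] by auto
  moreover have "(0, 0) \<in> path_points m I"
    unfolding path_points_def by (rule image_eqI[of _ _ 0]) auto
  ultimately show ?thesis using c by (auto simp: path_pattern_def)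
next
  case False
  have x: "- 1 \<le> x" using cell_bounds(1)[OF c] .
  let ?c = "\<lambda>t. card (I \<inter> {1..t})"
  have "(\<exists>(u, v)\<in>path_points m I. u \<le> x \<and> y + 1 \<le> v)
      \<longleftrightarrow> (\<exists>t\<le>m. int t - int (?c t) \<le> x \<and> y + 1 \<le> int (?c t))"
    by (force simp: path_points_def path_point_eq)
  also have "\<dots> \<longleftrightarrow> (\<exists>j\<in>I. j \<le> nat (x + y + 1) \<and> ?c j = nat (y + 1))"
  proof
    assume "\<exists>t\<le>m. int t - int (?c t) \<le> x \<and> y + 1 \<le> int (?c t)"
    then obtain t where t: "t \<le> m" "int t - int (?c t) \<le> x" "y + 1 \<le> int (?c t)" by blast
    \<comment> \<open>The step at which the path first attains height \<open>y + 1\<close>; it is a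
      north step and comes no later than \<open>t\<close>.\<close>
    define j where "j = (LEAST j. nat (y + 1) \<le> ?c j)"
    have j: "nat (y + 1) \<le> ?c j" unfolding j_def by (rule LeastI[of _ t]) (use t in simp)
    have jt: "j \<le> t" unfolding j_def by (rule Least_le) (use t in simp)
    obtain i where i: "j = Suc i" using j False by (cases j) auto
    have less: "?c i < nat (y + 1)"
      using not_less_Least[of i "\<lambda>j. nat (y + 1) \<le> ?c j"] i by (simp add: j_def)
    have split: "I \<inter> {1..j} = (if j \<in> I then insert j (I \<inter> {1..i}) else I \<inter> {1..i})"
      unfolding i by (auto simp: le_Suc_eq)
    have "j \<in> I" using less j split by (auto split: if_splits)
    with split have "?c j = Suc (?c i)" by (simp add: i)
    with less j have cj: "?c j = nat (y + 1)" by simp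
    \<comment> \<open>The abscissa never decreases along the path, so at \<open>j\<close> it is at
      most that at \<open>t\<close>.\<close>
    have "I \<inter> {1..t} \<subseteq> (I \<inter> {1..j}) \<union> {j<..t}" by auto
    then have "?c t \<le> ?c j + (t - j)"
      using card_mono[of "(I \<inter> {1..j}) \<union> {j<..t}" "I \<inter> {1..t}"] card_Un_le[of "I \<inter> {1..j}" "{j<..t}"] by simp
    then have "int j - int (?c j) \<le> x" using t jt by linarith
    then have "j \<le> nat (x + y + 1)" using cj False by simp
    with \<open>j \<in> I\<close> cj show "\<exists>j\<in>I. j \<le> nat (x + y + 1) \<and> ?c j = nat (y + 1)" by blast
  next
    assume "\<exists>j\<in>I. j \<le> nat (x + y + 1) \<and> ?c j = nat (y + 1)"
    then obtain j where "j \<in> I" "j \<le> nat (x + y + 1)" "?c j = nat (y + 1)" by blast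
    then show "\<exists>t\<le>m. int t - int (?c t) \<le> x \<and> y + 1 \<le> int (?c t)"
      using I False x by (intro exI[of _ j]) auto
  qed
  finally show ?thesis using c False by (simp add: path_pattern_def psum_path_exp[OF I])
qed

text \<open>The end of the path lies on the antidiagonal of the sinks, where the only nodes are the
  selected sinks.\<close>

lemma subsets_in_D:
  assumes A: "partial_staircase m A" and I: "I \<in> subsets_in m A"
  shows "I \<subseteq> {1..m}" "(int (m - card I), int (card I)) \<in> A"
proof -
  show sub: "I \<subseteq> {1..m}" using I by (simp add: subsets_in_def)
  have "path_point I m \<in> nodes A" using I by (auto simp: subsets_in_def path_points_def)
  moreover have "I \<inter> {1..m} = I" using sub by auto
  ultimately have "(int m - int (card I), int (card I)) \<in> nodes A" by (simp add: path_point_eq)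
  then obtain a b where ab: "(a, b) \<in> A" "int m - int (card I) \<le> a" "int (card I) \<le> b"
    by (auto simp: nodes_def)
  then obtain k where "k \<le> m" "a = int (m - k)" "b = int k"
    using A by (auto simp: partial_staircase_def sinks_def)
  with ab have "k = card I" by auto
  with ab \<open>a = _\<close> \<open>b = _\<close> show "(int (m - card I), int (card I)) \<in> A" by simp
qed

section \<open>Homogeneity, invariance and shapes of tableau monomials\<close>

lemma row_homogeneous_one: "row_homogeneous m (\<lambda>r. 0) 1"
  by (simp add: row_homogeneous_def)

lemma row_homogeneous_mult:
  assumes f: "row_homogeneous m d f" and g: "row_homogeneous m d' g"
  shows "row_homogeneous m (\<lambda>r. d r + d' r) (f * g)"
  unfolding row_homogeneous_def
proof (intro ballI)
  fix e assume "e \<in> keys (f * g)"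
  then obtain a b where ab: "e = a + b" "a \<in> keys f" "b \<in> keys g" using keys_mult[of f g] by blast
  have "keys e \<subseteq> keys a \<union> keys b" unfolding ab(1) by (rule keys_add)
  then have "keys e \<subseteq> {1..m} \<times> {1..m}"
    using f g ab(2,3) unfolding row_homogeneous_def by blast
  moreover have "rowdeg m r e = d r + d' r" for r
    using f g ab(2,3) unfolding row_homogeneous_def by (simp add: ab(1) rowdeg_add)
  ultimately show "keys e \<subseteq> {1..m} \<times> {1..m} \<and> (\<forall>r. rowdeg m r e = d r + d' r)" by blast
qed

lemma keys_diff_const_mult: "keys (f - const a * g) \<subseteq> keys f \<union> keys g"
  by (auto simp: in_keys_iff lookup_minus lookup_const_mult)

lemma row_homogeneous_diff:
  assumes "row_homogeneous m d f" "row_homogeneous m d g"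
  shows "row_homogeneous m d (f - const a * g)"
  using assms keys_diff_const_mult[of f a g] unfolding row_homogeneous_def by blast

lemma row_invariant_diff:
  assumes "row_invariant f" "row_invariant g"
  shows "row_invariant (f - const a * g)"
  using assms unfolding row_invariant_def by (simp add: subst.hom_minus subst_mult)

definition tab_exp :: "nat set multiset \<Rightarrow> expo" where
  "tab_exp T = (\<Sum>I\<in>#T. path_exp I)"

text \<open>The row lengths of the tableau, conjugate to its column heights.\<close>

definition tab_shape :: "nat set multiset \<Rightarrow> nat \<Rightarrow> nat" where
  "tab_shape T r = (\<Sum>I\<in>#T. of_bool (1 \<le> r \<and> r \<le> card I))"

lemma lead_tableau:
  assumes "\<And>I. I \<in># T \<Longrightarrow> I \<subseteq> {1..m}"
  shows "lead prodwt (tableau_monomial m T) (tab_exp T)"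
  unfolding tableau_monomial_def tab_exp_def by (intro lead_prod_mset lead_minor assms)

lemma row_homogeneous_tableau:
  assumes "\<And>I. I \<in># T \<Longrightarrow> I \<subseteq> {1..m}"
  shows "row_homogeneous m (tab_shape T) (tableau_monomial m T)"
  using assms
proof (induction T)
  case empty
  then show ?case
    using row_homogeneous_one by (simp add: tab_shape_def[abs_def] tableau_monomial_def)
next
  case (add I T)
  have "row_homogeneous m (\<lambda>r. of_bool (1 \<le> r \<and> r \<le> card I) + tab_shape T r) (minor m I * tableau_monomial m T)"
    by (intro row_homogeneous_mult row_homogeneous_minor add) (use add in auto)
  then show ?case by (simp add: tab_shape_def[abs_def] tableau_monomial_def)
qed

lemma row_invariant_tableau:
  assumes "\<And>I. I \<in># T \<Longrightarrow> I \<subseteq> {1..m}"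
  shows "row_invariant (tableau_monomial m T)"
  unfolding row_invariant_def tableau_monomial_def subst_prod_mset
proof (intro allI impI)
  fix r v assume "1 \<le> (r::nat)"
  then have "subst (row_op r v) (minor m I) = subst v (minor m I)" if "I \<in># T" for I
    using row_invariant_minor[OF assms[OF that]] unfolding row_invariant_def by blast
  then show "(\<Prod>I\<in>#T. subst (row_op r v) (minor m I)) = (\<Prod>I\<in>#T. subst v (minor m I))"
    by (intro arg_cong[where f = prod_mset] image_mset_cong)
qed

text \<open>Two consecutive rows differ in length only if a column ends between them, and columns
  have heights of selected sinks.\<close>

lemma tab_shape_sink:
  assumes A: "partial_staircase m A" and T: "set_mset T \<subseteq> subsets_in m A"
    and r: "1 \<le> r" and ne: "tab_shape T r \<noteq> tab_shape T (Suc r)"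
  shows "(int (m - r), int r) \<in> A"
proof -
  have "\<exists>I\<in>#T. card I = r"
  proof (rule ccontr)
    assume "\<not> (\<exists>I\<in>#T. card I = r)"
    then have "tab_shape T r = tab_shape T (Suc r)"
      unfolding tab_shape_def using r
      by (intro arg_cong[where f = sum_mset] image_mset_cong) (auto simp: le_Suc_eq Suc_le_eq order.order_iff_strict)
    with ne show False by simp
  qed
  then obtain I where "I \<in># T" "card I = r" by blast
  with subsets_in_D(2)[OF A, of I] T show ?thesis by auto
qed

text \<open>This replaces straightening: it identifies the initial monomials of all elements of the algebra.\<close>

lemma top_ssyt:
  assumes hom: "row_homogeneous m d f" and inv: "row_invariant f"
    and sink: "\<And>r. 1 \<le> r \<Longrightarrow> d r \<noteq> d (Suc r) \<Longrightarrow> (int (m - r), int r) \<in> A"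
    and M: "M \<in> keys f" "\<And>e. e \<in> keys f \<Longrightarrow> wt prodwt e \<le> wt prodwt M"
  shows "ssyt m A M"
proof -
  have "keys M \<subseteq> {1..m} \<times> {1..m}" and d: "rowdeg m r M = d r" for r
    using hom M(1) by (simp_all add: row_homogeneous_def)
  then show ?thesis
    unfolding ssyt_def d using top_interlace[OF hom inv _ M] sink by blast
qed

lemma sum_count:
  fixes g :: "'a \<Rightarrow> real"
  assumes "finite S" "set_mset T \<subseteq> S"
  shows "(\<Sum>I\<in>S. real (count T I) * g I) = (\<Sum>I\<in>#T. g I)"
  using assms(2)
proof (induction T)
  case (add x T)
  have "(\<Sum>I\<in>S. real (count (add_mset x T) I) * g I)
      = (\<Sum>I\<in>S. (if I = x then g I else 0) + real (count T I) * g I)"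
    by (rule sum.cong) (auto simp: algebra_simps)
  also have "\<dots> = g x + (\<Sum>I\<in>S. real (count T I) * g I)"
    using add.prems assms(1) by (simp add: sum.distrib)
  finally show ?case using add by simp
qed simp

lemma tab_exp_empty: "tab_exp {#} = 0"
  and tab_exp_add: "tab_exp (add_mset I T) = path_exp I + tab_exp T"
  by (simp_all add: tab_exp_def)

section \<open>Tableaux, semistandard exponents and their patterns\<close>

context
  fixes m :: nat and A :: "(int \<times> int) set"
  assumes A: "partial_staircase m A"
begin

text \<open>Interlacing is inherited from algebra instead of being checked on paths:
  \<open>tab_exp T\<close> is the leading exponent of the tableau monomial, to which
  \<open>top_ssyt\<close> applies.\<close>

lemma
  assumes T: "set_mset T \<subseteq> subsets_in m A"
  shows ssyt_tab_exp: "ssyt m A (tab_exp T)" and rowdeg_tab_exp: "rowdeg m r (tab_exp T) = tab_shape T r"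
proof -
  have sub: "I \<subseteq> {1..m}" if "I \<in># T" for I
    using subsets_in_D(1)[OF A, of I] T that by blast
  note L = lead_tableau[of T m, OF sub]
  have k: "tab_exp T \<in> keys (tableau_monomial m T)" using L by (simp add: lead_def in_keys_iff)
  show "ssyt m A (tab_exp T)"
    by (rule top_ssyt[OF row_homogeneous_tableau[of T m, OF sub] row_invariant_tableau[of T m, OF sub] _ k])
      (use tab_shape_sink[OF A T] lead_wt_le[OF L] in auto)
  show "rowdeg m r (tab_exp T) = tab_shape T r"
    using row_homogeneous_tableau[of T m, OF sub] k by (simp add: row_homogeneous_def)
qed

lemma sum_path_pattern:
  assumes T: "set_mset T \<subseteq> subsets_in m A" and c: "(x, y) \<in> cells A"
  shows "(\<Sum>I\<in>#T. path_pattern m A I (x, y)) =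
    (if y < 0 then real (size T) else real (psum (nat (y + 1)) (nat (x + y + 1)) (tab_exp T)))"
  using T
proof (induction T)
  case (add I T)
  have "I \<subseteq> {1..m}" using subsets_in_D(1)[OF A, of I] add.prems by simp
  from path_pattern_eq[OF this c] add show ?case by (simp add: tab_exp_add psum_add)
qed (simp add: tab_exp_empty)

lemma tab_shape_1:
  assumes T: "set_mset T \<subseteq> subsets_in m A" and ne: "{} \<notin># T"
  shows "tab_shape T 1 = size T"
  using assms
proof (induction T)
  case (add I T)
  have "finite I" using subsets_in_D(1)[OF A, of I] add.prems finite_subset by auto
  then have "1 \<le> card I" using add.prems by (cases "I = {}") (auto simp: Suc_le_eq card_gt_0_iff)
  then show ?case using add by (simp add: tab_shape_def)
qed (simp add: tab_shape_def)

text \<open>Multiplicities serve as coefficients. In the cells below the staircase every path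
  contributes 1, so the size of \<open>T\<close> has to equal the degree of row 1; this holds as
  \<open>T\<close> avoids the empty set.\<close>

lemma decomposition_tableau:
  assumes T: "T \<in> tableaux m A c" and ne: "{} \<notin># T"
  shows "decomposition m A c (exp_pattern m A (tab_exp T)) (\<lambda>I. real (count T I))"
proof -
  have supp: "{I. real (count T I) \<noteq> 0} = set_mset T" by auto
  have F: "set_mset T \<in> faces m A c" using T by (auto simp: tableaux_def tableaux_on_def)
  then have sub: "set_mset T \<subseteq> subsets_in m A" by (simp add: faces_def)
  have "exp_pattern m A (tab_exp T) C = (\<Sum>I\<in>set_mset T. real (count T I) * path_pattern m A I C)" for C
  proof (cases C)
    case (Pair x y)
    show ?thesis
    proof (cases "(x, y) \<in> cells A")
      case True
      then show ?thesis
        unfolding Pair sum_count[of "set_mset T" T, simplified] sum_path_pattern[OF sub True]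
        using rowdeg_tab_exp[OF sub, of 1] tab_shape_1[OF sub ne] by (simp add: exp_pattern_def)
    next
      case False
      then show ?thesis by (simp add: Pair exp_pattern_def path_pattern_def)
    qed
  qed
  then show ?thesis unfolding decomposition_def supp using F by auto
qed

lemma tab_exp_inj:
  assumes tri: "triangulates m A c" and T: "T \<in> tableaux m A c" "{} \<notin># T"
    and T': "T' \<in> tableaux m A c" "{} \<notin># T'" and eq: "tab_exp T = tab_exp T'"
  shows "T = T'"
proof -
  have "set_mset T \<subseteq> subsets_in m A" using T by (auto simp: tableaux_def tableaux_on_def faces_def)
  then have "exp_pattern m A (tab_exp T) \<in> GT A" by (intro exp_pattern_GT[OF A] ssyt_tab_exp)
  then have "\<exists>!a. decomposition m A c (exp_pattern m A (tab_exp T)) a"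
    using tri by (simp add: triangulates_def)
  then have "(\<lambda>I. real (count T I)) = (\<lambda>I. real (count T' I))"
    using decomposition_tableau[OF T] decomposition_tableau[OF T'] eq by auto
  then have "count T I = count T' I" for I by (metis of_nat_eq_iff)
  then show ?thesis by (rule multiset_eqI)
qed

lemma tableau_of_ssyt:
  assumes int: "integral_decompositions m A c" and e: "ssyt m A e"
  obtains T where "T \<in> tableaux m A c" "tab_exp T = e"
proof -
  obtain a where dec: "decomposition m A c (exp_pattern m A e) a" and aZ: "range a \<subseteq> \<int>"
    using int exp_pattern_GT[OF A e] exp_pattern_int[OF A e] unfolding integral_decompositions_def by blast
  let ?F = "{I. a I \<noteq> 0}"
  have F: "?F \<in> faces m A c" and a0: "\<And>I. 0 \<le> a I"
    and pat: "exp_pattern m A e = (\<lambda>C. \<Sum>I\<in>?F. a I * path_pattern m A I C)"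
    using dec by (auto simp: decomposition_def)
  have sub: "?F \<subseteq> subsets_in m A" using F by (simp add: faces_def)
  have "?F \<subseteq> Pow {1..m}" using sub by (auto simp: subsets_in_def)
  then have fin: "finite ?F" by (rule finite_subset) simp
  \<comment> \<open>By integrality the rounding is exact, and the nonnegative coefficients are
    multiplicities.\<close>
  define T where "T = (\<Sum>I\<in>?F. replicate_mset (nat \<lfloor>a I\<rfloor>) I)"
  have cnt: "real (count T I) = a I" for I
  proof -
    have "a I \<in> \<int>" using aZ by auto
    then have "real (nat \<lfloor>a I\<rfloor>) = a I" using a0[of I] by (auto elim!: Ints_cases)
    moreover have "count T I = (\<Sum>J\<in>?F. if J = I then nat \<lfloor>a J\<rfloor> else 0)"
      unfolding T_def count_sum by (rule sum.cong) auto
    then have "count T I = (if a I \<noteq> 0 then nat \<lfloor>a I\<rfloor> else 0)" using fin by simp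
    ultimately show ?thesis by auto
  qed
  have set: "set_mset T = ?F"
  proof (rule Set.set_eqI)
    fix I show "I \<in># T \<longleftrightarrow> I \<in> ?F"
      by (simp flip: cnt)
  qed
  have TT: "T \<in> tableaux m A c" using F by (simp add: tableaux_def tableaux_on_def set)
  have T: "set_mset T \<subseteq> subsets_in m A" using sub by (simp add: set)
  have "tab_exp T = e"
  proof (rule ssyt_eqI[OF A ssyt_tab_exp[OF T] e])
    fix x y assume c: "(x, y) \<in> cells A" and y: "0 \<le> (y::int)"
    have "real (psum (nat (y + 1)) (nat (x + y + 1)) e) = (\<Sum>I\<in>?F. a I * path_pattern m A I (x, y))"
      using fun_cong[OF pat, of "(x, y)"] c y by (simp add: exp_pattern_def)
    also have "\<dots> = (\<Sum>I\<in>#T. path_pattern m A I (x, y))"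
      using sum_count[OF fin, of T "\<lambda>I. path_pattern m A I (x, y)"] by (simp add: set cnt)
    also have "\<dots> = real (psum (nat (y + 1)) (nat (x + y + 1)) (tab_exp T))"
      using sum_path_pattern[OF T c] y by simp
    finally show "psum (nat (y + 1)) (nat (x + y + 1)) (tab_exp T) = psum (nat (y + 1)) (nat (x + y + 1)) e"
      by simp
  qed
  with TT that show ?thesis by blast
qed

section \<open>The basis property\<close>

text \<open>Nested inductions: \<open>n\<close> bounds the weights, and \<open>k\<close> counts the
  exponents of top weight. The tableau monomial has a single exponent of that weight, so subtracting
  its multiple removes \<open>M\<close> from the top layer and adds nothing there.\<close>

lemma row_invariant_in_span:
  assumes int: "integral_decompositions m A c"
    and sink: "\<And>r. 1 \<le> r \<Longrightarrow> d r \<noteq> d (Suc r) \<Longrightarrow> (int (m - r), int r) \<in> A"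
    and "row_homogeneous m d f" "row_invariant f" "\<And>e. e \<in> keys f \<Longrightarrow> wt prodwt e < int n"
  shows "f \<in> cpoly.span (tableau_monomial m ` tableaux m A c)"
  using assms(3-5)
proof (induction n arbitrary: f)
  case 0
  have nonneg: "0 \<le> wt prodwt e" for e unfolding wt_def by (intro sum_nonneg) auto
  have "e \<notin> keys f" for e using 0(3)[of e] nonneg[of e] by auto
  then have "keys f = {}" by blast
  then show ?case using cpoly.span_zero by simp
next
  case (Suc n)
  note outer = Suc.IH
  let ?top = "\<lambda>f. {e \<in> keys f. wt prodwt e = int n}"
  have "f \<in> cpoly.span (tableau_monomial m ` tableaux m A c)"
    if "row_homogeneous m d f" "row_invariant f" "\<And>e. e \<in> keys f \<Longrightarrow> wt prodwt e < int (Suc n)" "card (?top f) = k" for f k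
    using that
  proof (induction k arbitrary: f)
    case 0
    then have "?top f = {}" by simp
    then have "wt prodwt e < int n" if "e \<in> keys f" for e
      using 0(3)[OF that] that by fastforce
    then show ?case using outer 0 by blast
  next
    case (Suc k)
    have "?top f \<noteq> {}" using Suc.prems(4) by (metis card.empty nat.distinct(1))
    then obtain M where M: "M \<in> keys f" "wt prodwt M = int n" by blast
    have top: "wt prodwt e \<le> wt prodwt M" if "e \<in> keys f" for e
      using Suc.prems(3)[OF that] M by simp
    have "ssyt m A M" by (rule top_ssyt[OF Suc.prems(1,2) sink M(1) top])
    then obtain T where T: "T \<in> tableaux m A c" "tab_exp T = M" using tableau_of_ssyt[OF int] by blast
    then have sub: "I \<subseteq> {1..m}" if "I \<in># T" for I
      using that subsets_in_D(1)[OF A, of I] by (auto simp: tableaux_def tableaux_on_def faces_def)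
    let ?x = "tableau_monomial m T"
    have L: "lead prodwt ?x M" using lead_tableau[of T m, OF sub] T by simp
    have hom: "row_homogeneous m (tab_shape T) ?x" by (rule row_homogeneous_tableau[OF sub])
    have "M \<in> keys ?x" using L by (simp add: lead_def in_keys_iff)
    \<comment> \<open>\<open>M\<close> occurs in both polynomials, so their row degrees agree and
      the difference stays homogeneous.\<close>
    then have "tab_shape T = d" using hom Suc.prems(1) M(1) by (auto simp: row_homogeneous_def fun_eq_iff)
    with hom have hom: "row_homogeneous m d ?x" by simp
    define \<alpha> where "\<alpha> = lookup f M / lookup ?x M"
    let ?g = "f - const \<alpha> * ?x"
    have M0: "lookup ?g M = 0" using L by (simp add: lookup_minus lookup_const_mult \<alpha>_def lead_def)
    have keys_g: "keys ?g \<subseteq> keys f \<union> keys ?x" by (rule keys_diff_const_mult)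
    have "?top ?g = ?top f - {M}"
    proof (intro equalityI subsetI)
      fix e assume e: "e \<in> ?top ?g"
      then have "e \<noteq> M" using M0 by (auto simp: in_keys_iff)
      moreover from this e have "e \<notin> keys ?x" using L M(2) by (auto simp: lead_def)
      ultimately show "e \<in> ?top f - {M}" using e keys_g by auto
    next
      fix e assume e: "e \<in> ?top f - {M}"
      then have "e \<notin> keys ?x" using L M(2) by (auto simp: lead_def)
      with e show "e \<in> ?top ?g" by (simp add: in_keys_iff lookup_minus lookup_const_mult)
    qed
    then have "card (?top ?g) = k" using Suc.prems(4) M by simp
    moreover have "wt prodwt e < int (Suc n)" if "e \<in> keys ?g" for e
      using that keys_g Suc.prems(3) lead_wt_le[OF L] M(2) by fastforce
    moreover have "row_homogeneous m d ?g" "row_invariant ?g"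
      by (intro row_homogeneous_diff row_invariant_diff Suc.prems hom row_invariant_tableau sub; assumption)+
    ultimately have "?g \<in> cpoly.span (tableau_monomial m ` tableaux m A c)"
      by (intro Suc.IH)
    moreover have "cscale \<alpha> ?x \<in> cpoly.span (tableau_monomial m ` tableaux m A c)"
      by (intro cpoly.span_scale cpoly.span_base imageI T)
    ultimately have "?g + cscale \<alpha> ?x \<in> cpoly.span (tableau_monomial m ` tableaux m A c)"
      by (rule cpoly.span_add)
    moreover have "?g + cscale \<alpha> ?x = f" by (simp add: cscale_def)
    ultimately show ?case by simp
  qed
  with Suc.prems show ?case by blast
qed

lemma monomial_in_span:
  assumes int: "integral_decompositions m A c" and S: "set_mset S \<subseteq> subsets_in m A"
  shows "tableau_monomial m S \<in> cpoly.span (tableau_monomial m ` tableaux m A c)"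
proof -
  have sub: "I \<subseteq> {1..m}" if "I \<in># S" for I
    using that subsets_in_D(1)[OF A, of I] S by auto
  have "wt prodwt e < int (Suc (nat (wt prodwt (tab_exp S))))" if "e \<in> keys (tableau_monomial m S)" for e
    using lead_wt_le[OF lead_tableau[of S m, OF sub] that] by linarith
  then show ?thesis
    using row_invariant_in_span[OF int, of "tab_shape S"] tab_shape_sink[OF A S]
      row_homogeneous_tableau[of S m, OF sub] row_invariant_tableau[of S m, OF sub] by blast
qed

end

section \<open>The generated subalgebra as a linear span; independence from leading
  exponents\<close>

lemma tableau_monomial_empty: "tableau_monomial m {#} = 1"
  and tableau_monomial_add: "tableau_monomial m (add_mset I T) = minor m I * tableau_monomial m T"
  and tableau_monomial_union: "tableau_monomial m (S + T) = tableau_monomial m S * tableau_monomial m T"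
  by (simp_all add: tableau_monomial_def)

lemma cscale_mult_left: "cscale z p * q = cscale z (p * q)"
  by (simp add: cscale_def mult.assoc)

lemma cscale_mult_right: "p * cscale z q = cscale z (p * q)"
  by (simp add: cscale_def mult.left_commute)

lemma span_mult_closed:
  assumes closed: "\<And>p q. p \<in> P \<Longrightarrow> q \<in> P \<Longrightarrow> p * q \<in> P"
    and p: "p \<in> cpoly.span P" and q: "q \<in> cpoly.span P"
  shows "p * q \<in> cpoly.span P"
proof -
  have 1: "x * y \<in> cpoly.span P" if "x \<in> cpoly.span P" "y \<in> P" for x y
    using that(1)
  proof (rule cpoly.span_induct)
    show "cpoly.subspace {x. x * y \<in> cpoly.span P}"
      by (rule cpoly.subspaceI)
        (auto simp: distrib_right cscale_mult_left intro: cpoly.span_zero cpoly.span_add cpoly.span_scale)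
  qed (use that(2) closed in \<open>auto intro: cpoly.span_base\<close>)
  show ?thesis
    using q
  proof (rule cpoly.span_induct)
    show "cpoly.subspace {y. p * y \<in> cpoly.span P}"
      by (rule cpoly.subspaceI)
        (auto simp: distrib_left cscale_mult_right intro: cpoly.span_zero cpoly.span_add cpoly.span_scale)
  qed (use 1 p in auto)
qed

lemma generated_subalgebra_eq_span:
  "generated_subalgebra (minor m ` G) = cpoly.span (tableau_monomial m ` {S. set_mset S \<subseteq> G})"
proof (intro equalityI subsetI)
  fix p assume "p \<in> generated_subalgebra (minor m ` G)"
  then show "p \<in> cpoly.span (tableau_monomial m ` {S. set_mset S \<subseteq> G})"
  proof induction
    case (const z)
    have "cscale z (tableau_monomial m {#}) \<in> cpoly.span (tableau_monomial m ` {S. set_mset S \<subseteq> G})"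
      by (intro cpoly.span_scale cpoly.span_base imageI) simp
    moreover have "cscale z (tableau_monomial m {#}) = const z"
      by (simp add: cscale_def tableau_monomial_empty)
    ultimately show ?case by simp
  next
    case (gen p)
    then obtain I where "I \<in> G" "p = tableau_monomial m {#I#}"
      by (auto simp: tableau_monomial_def)
    then show ?case by (intro cpoly.span_base) auto
  next
    case (add p q)
    then show ?case by (intro cpoly.span_add)
  next
    case (mult p q)
    have "x * y \<in> tableau_monomial m ` {S. set_mset S \<subseteq> G}"
      if "x \<in> tableau_monomial m ` {S. set_mset S \<subseteq> G}" "y \<in> tableau_monomial m ` {S. set_mset S \<subseteq> G}" for x y
    proof -
      from that obtain S S' where "set_mset S \<subseteq> G" "set_mset S' \<subseteq> G"
        "x = tableau_monomial m S" "y = tableau_monomial m S'" by auto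
      then show ?thesis by (intro image_eqI[of _ _ "S + S'"]) (auto simp: tableau_monomial_union)
    qed
    from span_mult_closed[OF this mult.IH] show ?case .
  qed
next
  fix p assume p: "p \<in> cpoly.span (tableau_monomial m ` {S. set_mset S \<subseteq> G})"
  let ?R = "generated_subalgebra (minor m ` G)"
  have "tableau_monomial m S \<in> ?R" if "set_mset S \<subseteq> G" for S
    using that
  proof (induction S)
    case empty
    then show ?case using generated_subalgebra.const[of 1] by (simp add: tableau_monomial_empty)
  next
    case (add I S)
    then have "minor m I \<in> ?R" "tableau_monomial m S \<in> ?R" by (auto intro: generated_subalgebra.gen)
    then show ?case unfolding tableau_monomial_add by (rule generated_subalgebra.mult)
  qed
  moreover have "cpoly.subspace ?R"
    by (rule cpoly.subspaceI)
      (use generated_subalgebra.const[of 0] in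
        \<open>auto simp: cscale_def intro: generated_subalgebra.intros\<close>)
  ultimately show "p \<in> ?R" using cpoly.span_minimal[of "tableau_monomial m ` {S. set_mset S \<subseteq> G}" ?R] p by blast
qed

text \<open>Among the vectors with nonzero coefficient in a relation, choose \<open>v\<close> with
  leading exponent of greatest weight. In another such vector \<open>L v\<close> would lie strictly
  below the leading exponent, against this choice, so \<open>L v\<close> keeps a nonzero coefficient
  in the sum.\<close>

lemma independent_if_distinct_leads:
  assumes lead: "\<And>b. b \<in> B \<Longrightarrow> lead u b (L b)" and inj: "inj_on L B"
  shows "cpoly.independent B"
proof
  assume "cpoly.dependent B"
  then obtain S a where S: "finite S" "S \<subseteq> B" "(\<Sum>b\<in>S. cscale (a b) b) = 0" "\<exists>b\<in>S. a b \<noteq> 0"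
    unfolding cpoly.dependent_explicit by blast
  define S' where "S' = {b \<in> S. a b \<noteq> 0}"
  have S': "finite S'" "S' \<noteq> {}" "S' \<subseteq> B" using S by (auto simp: S'_def)
  have "Max ((\<lambda>b. wt u (L b)) ` S') \<in> (\<lambda>b. wt u (L b)) ` S'" by (rule Max_in) (use S' in auto)
  then obtain v where v: "v \<in> S'" "wt u (L v) = Max ((\<lambda>b. wt u (L b)) ` S')" by auto
  have vmax: "wt u (L b) \<le> wt u (L v)" if "b \<in> S'" for b
    unfolding v(2) by (rule Max_ge) (use S' that in auto)
  have zero: "a b * lookup b (L v) = 0" if "b \<in> S" "b \<noteq> v" for b
  proof (rule ccontr)
    assume ne: "a b * lookup b (L v) \<noteq> 0"
    then have b: "b \<in> S'" "L v \<in> keys b" using that by (auto simp: S'_def in_keys_iff)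
    have "v \<in> B" "b \<in> B" using b v S' by auto
    then have "L v \<noteq> L b" using inj_onD[OF inj, of v b] that by blast
    then have "wt u (L v) < wt u (L b)" using lead[of b] b S' by (auto simp: lead_def)
    with vmax[OF b(1)] show False by simp
  qed
  have "0 = lookup (\<Sum>b\<in>S. cscale (a b) b) (L v)" using S(3) by simp
  also have "\<dots> = (\<Sum>b\<in>S. a b * lookup b (L v))" by (simp add: lookup_sum cscale_def lookup_const_mult)
  also have "\<dots> = (\<Sum>b\<in>{v}. a b * lookup b (L v))"
    by (rule sum.mono_neutral_right) (use S zero v in \<open>auto simp: S'_def\<close>)
  also have "\<dots> \<noteq> 0" using lead[of v] v S' by (auto simp: lead_def S'_def)
  finally show False by simp
qed

lemma minor_empty: "minor m {} = 1"
  by (simp add: minor_eq)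

lemma tableau_monomial_filter: "tableau_monomial m (filter_mset (\<lambda>I. I \<noteq> {}) T) = tableau_monomial m T"
  by (induction T) (simp_all add: tableau_monomial_add minor_empty tableau_monomial_empty)

lemma tableaux_filter: "T \<in> tableaux m A c \<Longrightarrow> filter_mset P T \<in> tableaux m A c"
  by (auto simp: tableaux_def tableaux_on_def faces_def)

theorem corollary4p3:
  fixes m :: nat and A :: "(int \<times> int) set" and c :: "nat set set set"
  assumes "m \<ge> 1"
    and "partial_staircase m A"
    and "compatibility_condition m c"
    and "triangulates m A c"
    and "integral_decompositions m A c"
  shows "inj_on (tableau_monomial m) {T \<in> tableaux m A c. {} \<notin># T}
    \<and> cpoly.independent (tableau_monomial m ` tableaux m A c)
    \<and> cpoly.span (tableau_monomial m ` tableaux m A c)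
        = generated_subalgebra (minor m ` subsets_in m A)"
proof -
  note A = assms(2) and tri = assms(4) and int = assms(5)
  define T0 where "T0 = {T \<in> tableaux m A c. {} \<notin># T}"
  have sub: "set_mset T \<subseteq> subsets_in m A" if "T \<in> tableaux m A c" for T
    using that by (auto simp: tableaux_def tableaux_on_def faces_def)
  have lead: "lead prodwt (tableau_monomial m T) (tab_exp T)" if "T \<in> T0" for T
    by (rule lead_tableau) (use that sub[of T] subsets_in_D(1)[OF A] in \<open>auto simp: T0_def\<close>)
  have inj_exp: "T = T'" if "T \<in> T0" "T' \<in> T0" "tab_exp T = tab_exp T'" for T T'
    using tab_exp_inj[OF A tri] that by (auto simp: T0_def)
  have inj: "inj_on (tableau_monomial m) T0"
    by (rule inj_onI) (metis lead lead_unique inj_exp)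
  have image: "tableau_monomial m ` tableaux m A c = tableau_monomial m ` T0"
  proof
    show "tableau_monomial m ` tableaux m A c \<subseteq> tableau_monomial m ` T0"
    proof (rule image_subsetI)
      fix T assume "T \<in> tableaux m A c"
      then have "filter_mset (\<lambda>I. I \<noteq> {}) T \<in> T0" by (simp add: T0_def tableaux_filter)
      then show "tableau_monomial m T \<in> tableau_monomial m ` T0"
        by (rule rev_image_eqI) (simp add: tableau_monomial_filter)
    qed
  qed (auto simp: T0_def)
  have "cpoly.independent (tableau_monomial m ` T0)"
  proof (rule independent_if_distinct_leads)
    \<comment> \<open>The independence criterion is indexed by polynomials; injectivity on
      \<open>T0\<close> recovers the tableau from its monomial.\<close>
    let ?L = "\<lambda>b. tab_exp (inv_into T0 (tableau_monomial m) b)"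
    show "lead prodwt b (?L b)" if "b \<in> tableau_monomial m ` T0" for b
      using that lead inj by auto
    show "inj_on ?L (tableau_monomial m ` T0)"
    proof (rule inj_onI)
      fix b b' assume "b \<in> tableau_monomial m ` T0" "b' \<in> tableau_monomial m ` T0" "?L b = ?L b'"
      then obtain T T' where "T \<in> T0" "T' \<in> T0" "b = tableau_monomial m T" "b' = tableau_monomial m T'"
        "tab_exp T = tab_exp T'" using inj by auto
      then show "b = b'" using inj_exp[of T T'] by simp
    qed
  qed
  moreover have "cpoly.span (tableau_monomial m ` tableaux m A c) = generated_subalgebra (minor m ` subsets_in m A)"
    unfolding generated_subalgebra_eq_span
  proof
    show "cpoly.span (tableau_monomial m ` tableaux m A c)
        \<subseteq> cpoly.span (tableau_monomial m ` {S. set_mset S \<subseteq> subsets_in m A})"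
      by (rule cpoly.span_mono) (use sub in auto)
    show "cpoly.span (tableau_monomial m ` {S. set_mset S \<subseteq> subsets_in m A})
        \<subseteq> cpoly.span (tableau_monomial m ` tableaux m A c)"
      by (rule cpoly.span_minimal) (auto intro: monomial_in_span[OF A int] cpoly.subspace_span)
  qed
  ultimately show ?thesis using inj image by (simp add: T0_def)
qed

end
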